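(* Suppose that $F:\mathbb{R}^d\to\mathbb{R}$ is twice continuously differentiable and that there exist constants $0<\mu\le L$ such that $$\mu I\preceq \nabla^2F(x)\preceq LI\qquad\text{for all }x\in\mathbb{R}^d .$$ Let $\theta,\nu>0$ and $0<\Lambda_1\le\Lambda_2$ be constants. Let $\{x_k\}$ be generated by the stochastic quasi-Newton iteration $x_{k+1}=x_k-\alpha_kH_kg_k^{S_k}$ (described in the context) from an arbitrary $x_0\in\mathbb{R}^d$, where for every $k$: (i) the sample size $|S_k|$ satisfies the exact variance inner product quasi-Newton test $$\frac{\mathbb{E}_k\left[\left((H_k\nabla F(x_k))^T(H_kg_k^i)-\|H_k\nabla F(x_k)\|^2\right)^2\right]}{|S_k|}\le\theta^2\|H_k\nabla F(x_k)\|^4;$$ (ii) the orthogonality condition $$\frac{\mathbb{E}_k\left[\left\|H_kg_k^i-\frac{(H_kg_k^i)^T(H_k\nabla F(x_k))}{\|H_k\nabla F(x_k)\|^2}H_k\nabla F(x_k)\right\|^2\right]}{|S_k|}\le\nu^2\|H_k\nabla F(x_k)\|^2$$ holds; (iii) $\Lambda_1I\preceq H_k\preceq\Lambda_2I$. Then, if the steplength is a constant $\alpha_k=\alpha>0$ with $$\alpha\le\frac{1}{(1+\theta^2+\nu^2)L\Lambda_2},$$ we have, for all $k\ge0$, $$\mathbb{E}[F(x_k)-F(x^* )]\le\rho^k\,(F(x_0)-F(x^* )),\qquad \rho=1-\mu\Lambda_1\alpha,$$ where $x^*$ denotes the minimizer of $F$.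
   Context: Setting. $F(x)=\int f(x;z,y)\,dP(z,y)$ is the expected value of a loss over random data $(z,y)$ with distribution $P$. For a data point $(z^i,y^i)$ drawn from $P$, set $F_i(x)=f(x;z^i,y^i)$ and $g_k^i=\nabla F_i(x_k)$. The iteration is $$x_{k+1}=x_k-\alpha_kH_kg_k^{S_k},\qquad g_k^{S_k}=\frac1{|S_k|}\sum_{i\in S_k}\nabla F_i(x_k),$$ started from a deterministic $x_0$. At iteration $k$, the symmetric positive definite matrix $H_k$ and the sample size $|S_k|\geq 1$ are determined by the history before the sample $S_k$ is drawn (they may depend on the past iterates and samples but not on the draw of $S_k$). Given this history, $S_k$ indexes $|S_k|$ independent data points with distribution $P$. $\mathbb{E}_k$ denotes conditional expectation at $x_k$, i.e. given the history up to and including $x_k,H_k,|S_k|$; $\mathbb{E}$ denotes total expectation. Stochastic gradients are unbiased, $\mathbb{E}_k[g_k^i]=\nabla F(x_k)$, and have finite conditional second moments. In $\mathbb{E}_k[\cdot]$ of expressions involving $g_k^i$, $i$ is a single data point drawn from $P$ given the history. $\|\cdot\|$ is the Euclidean norm, and $A\preceq B$ means $B-A$ is positive semidefinite. If $\nabla F(x_k)=0$, the projection term (the fraction times $H_k\nabla F(x_k)$) in the orthogonality condition is read as $0$. *)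

theory Defs
  imports "HOL-Probability.Probability"
begin

definition gradient :: "('a::real_inner \<Rightarrow> real) \<Rightarrow> 'a \<Rightarrow> 'a" where
  "gradient \<phi> x = (THE D. GDERIV \<phi> x :> D)"

definition hessian :: "(real^'d \<Rightarrow> real) \<Rightarrow> real^'d \<Rightarrow> real^'d^'d" where
  "hessian \<phi> x = matrix (frechet_derivative (gradient \<phi>) (at x))"

definition twice_continuously_differentiable :: "(real^'d \<Rightarrow> real) \<Rightarrow> bool" where
  "twice_continuously_differentiable \<phi> \<longleftrightarrow>
     (\<forall>x. \<phi> differentiable at x) \<and>
     (\<forall>x. gradient \<phi> differentiable at x) \<and>
     continuous_on UNIV (hessian \<phi>)"

definition pos_semidefinite :: "real^'d^'d \<Rightarrow> bool" where
  "pos_semidefinite A \<longleftrightarrow> transpose A = A \<and> (\<forall>v. 0 \<le> v \<bullet> (A *v v))"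

definition pos_definite :: "real^'d^'d \<Rightarrow> bool" where
  "pos_definite A \<longleftrightarrow> transpose A = A \<and> (\<forall>v. v \<noteq> 0 \<longrightarrow> 0 < v \<bullet> (A *v v))"

definition loewner_le :: "real^'d^'d \<Rightarrow> real^'d^'d \<Rightarrow> bool" (infix \<open>\<preceq>\<close> 50) where
  "A \<preceq> B \<longleftrightarrow> pos_semidefinite (B - A)"

text \<open>\<open>\<xi> k i\<close> is the \<open>i\<close>-th data point of the \<open>k\<close>-th sample.\<close>

definition sample_gradient ::
  "(real^'d \<Rightarrow> 'p \<Rightarrow> real) \<Rightarrow> (nat \<Rightarrow> 'w \<Rightarrow> real^'d) \<Rightarrow> (nat \<Rightarrow> nat \<Rightarrow> 'w \<Rightarrow> 'p)
    \<Rightarrow> nat \<Rightarrow> nat \<Rightarrow> 'w \<Rightarrow> real^'d" where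
  "sample_gradient f x \<xi> k i \<omega> = gradient (\<lambda>y. f y (\<xi> k i \<omega>)) (x k \<omega>)"

definition batch_gradient ::
  "(real^'d \<Rightarrow> 'p \<Rightarrow> real) \<Rightarrow> (nat \<Rightarrow> 'w \<Rightarrow> real^'d) \<Rightarrow> (nat \<Rightarrow> nat \<Rightarrow> 'w \<Rightarrow> 'p)
    \<Rightarrow> (nat \<Rightarrow> 'w \<Rightarrow> nat) \<Rightarrow> nat \<Rightarrow> 'w \<Rightarrow> real^'d" where
  "batch_gradient f x \<xi> N k \<omega> =
     (1 / real (N k \<omega>)) *\<^sub>R (\<Sum>i<N k \<omega>. sample_gradient f x \<xi> k i \<omega>)"

text \<open>
  \<open>P\<close> is the data distribution, \<open>f\<close> the loss, \<open>N k\<close> the size of the \<open>k\<close>-th sample and \<open>G k\<close> the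
  history when that sample is about to be drawn, so that the conditional expectation given the
  history is \<open>real_cond_exp M (G k)\<close>. The history contains the past samples and \<open>x\<close>, \<open>H\<close>, \<open>N\<close>
  up to time \<open>k\<close>; it may be larger than the \<open>\<sigma>\<close>-algebra these generate.

  The \<open>k\<close>-th sample is \<open>\<xi> k 0, \<dots>, \<xi> k (N k - 1)\<close>. The variables \<open>\<xi> k i\<close> with \<open>i \<ge> N k\<close> are
  padding: they enter neither the iteration nor \<open>sample_law\<close>, and can be taken equal to
  \<open>\<xi> k 0\<close>. Since \<open>N k \<ge> 1\<close>, \<open>\<xi> k 0\<close> always is a single data point
  drawn from \<open>P\<close> given the history.

  \<open>real_cond_exp\<close> takes the junk value \<open>0\<close> where the conditional expectation of a nonnegative
  function is infinite; \<open>finite_second_moment\<close>, stated with \<open>nn_cond_exp\<close>, excludes this for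
  every expression at most quadratic in the stochastic gradient.
\<close>

locale stochastic_quasi_newton = prob_space M + filtration "space M" G
  for M :: "'w measure" and G :: "nat \<Rightarrow> 'w measure" +
  fixes P :: "('z \<times> 'y) measure"
    and f :: "real^'d \<Rightarrow> 'z \<times> 'y \<Rightarrow> real"
    and F :: "real^'d \<Rightarrow> real"
    and x0 :: "real^'d"
    and x :: "nat \<Rightarrow> 'w \<Rightarrow> real^'d"
    and H :: "nat \<Rightarrow> 'w \<Rightarrow> real^'d^'d"
    and N :: "nat \<Rightarrow> 'w \<Rightarrow> nat"
    and \<xi> :: "nat \<Rightarrow> nat \<Rightarrow> 'w \<Rightarrow> 'z \<times> 'y"
    and \<alpha> :: "nat \<Rightarrow> real"
  assumes prob_space_P: "prob_space P"
    and loss_integrable: "\<And>y. integrable P (f y)"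
    and loss_differentiable: "\<And>y p. p \<in> space P \<Longrightarrow> (\<lambda>u. f u p) differentiable at y"
    and F_eq: "\<And>y. F y = (\<integral>p. f y p \<partial>P)"
    and history_subalgebra: "\<And>k. subalgebra M (G k)"
    and x_history: "\<And>k. x k \<in> borel_measurable (G k)"
    and H_history: "\<And>k. H k \<in> borel_measurable (G k)"
    and N_history: "\<And>k. N k \<in> measurable (G k) (count_space UNIV)"
    and sample_history: "\<And>k i. \<xi> k i \<in> measurable (G (Suc k)) P"
    and H_pos_definite: "\<And>k \<omega>. \<omega> \<in> space M \<Longrightarrow> pos_definite (H k \<omega>)"
    and sample_size: "\<And>k \<omega>. \<omega> \<in> space M \<Longrightarrow> 1 \<le> N k \<omega>"
    and sample_law: "\<And>k B. (\<And>i. B i \<in> sets P) \<Longrightarrow>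
      AE \<omega> in M. real_cond_exp M (G k)
          (indicator {\<omega> \<in> space M. \<forall>i<N k \<omega>. \<xi> k i \<omega> \<in> B i}) \<omega>
        = (\<Prod>i<N k \<omega>. measure P (B i))"
    and unbiased: "\<And>k. AE \<omega> in M. \<forall>j.
      real_cond_exp M (G k) (\<lambda>\<omega>. sample_gradient f x \<xi> k 0 \<omega> $ j) \<omega> = gradient F (x k \<omega>) $ j"
    and finite_second_moment: "\<And>k. AE \<omega> in M.
      nn_cond_exp M (G k) (\<lambda>\<omega>. ennreal ((norm (sample_gradient f x \<xi> k 0 \<omega>))\<^sup>2)) \<omega> < \<infinity>"
    and initial: "\<And>\<omega>. \<omega> \<in> space M \<Longrightarrow> x 0 \<omega> = x0"
    and step: "\<And>k \<omega>. \<omega> \<in> space M \<Longrightarrow>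
      x (Suc k) \<omega> = x k \<omega> - \<alpha> k *\<^sub>R (H k \<omega> *v batch_gradient f x \<xi> N k \<omega>)"

text \<open>
  In the orthogonality condition, division by zero is zero, so that the projection term
  vanishes when the gradient of \<open>F\<close> does.
\<close>

definition inner_product_test ::
  "'w measure \<Rightarrow> (nat \<Rightarrow> 'w measure) \<Rightarrow> (real^'d \<Rightarrow> 'p \<Rightarrow> real) \<Rightarrow> (real^'d \<Rightarrow> real)
    \<Rightarrow> (nat \<Rightarrow> 'w \<Rightarrow> real^'d) \<Rightarrow> (nat \<Rightarrow> 'w \<Rightarrow> real^'d^'d) \<Rightarrow> (nat \<Rightarrow> 'w \<Rightarrow> nat)
    \<Rightarrow> (nat \<Rightarrow> nat \<Rightarrow> 'w \<Rightarrow> 'p) \<Rightarrow> real \<Rightarrow> nat \<Rightarrow> bool" where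
  "inner_product_test M G f F x H N \<xi> \<theta> k \<longleftrightarrow>
    (AE \<omega> in M.
      real_cond_exp M (G k)
        (\<lambda>\<omega>. ((H k \<omega> *v gradient F (x k \<omega>)) \<bullet> (H k \<omega> *v sample_gradient f x \<xi> k 0 \<omega>)
               - (norm (H k \<omega> *v gradient F (x k \<omega>)))\<^sup>2)\<^sup>2) \<omega> / real (N k \<omega>)
      \<le> \<theta>\<^sup>2 * norm (H k \<omega> *v gradient F (x k \<omega>)) ^ 4)"

definition orthogonality_condition ::
  "'w measure \<Rightarrow> (nat \<Rightarrow> 'w measure) \<Rightarrow> (real^'d \<Rightarrow> 'p \<Rightarrow> real) \<Rightarrow> (real^'d \<Rightarrow> real)
    \<Rightarrow> (nat \<Rightarrow> 'w \<Rightarrow> real^'d) \<Rightarrow> (nat \<Rightarrow> 'w \<Rightarrow> real^'d^'d) \<Rightarrow> (nat \<Rightarrow> 'w \<Rightarrow> nat)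
    \<Rightarrow> (nat \<Rightarrow> nat \<Rightarrow> 'w \<Rightarrow> 'p) \<Rightarrow> real \<Rightarrow> nat \<Rightarrow> bool" where
  "orthogonality_condition M G f F x H N \<xi> \<nu> k \<longleftrightarrow>
    (AE \<omega> in M.
      real_cond_exp M (G k)
        (\<lambda>\<omega>. (norm (H k \<omega> *v sample_gradient f x \<xi> k 0 \<omega>
               - (((H k \<omega> *v sample_gradient f x \<xi> k 0 \<omega>) \<bullet> (H k \<omega> *v gradient F (x k \<omega>)))
                    / (norm (H k \<omega> *v gradient F (x k \<omega>)))\<^sup>2)
                 *\<^sub>R (H k \<omega> *v gradient F (x k \<omega>))))\<^sup>2) \<omega> / real (N k \<omega>)
      \<le> \<nu>\<^sup>2 * (norm (H k \<omega> *v gradient F (x k \<omega>)))\<^sup>2)"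

end

theory Submission
  imports Defs
begin

text \<open>
  Fix the history at time \<open>k\<close>; then \<open>X = x k\<close>, \<open>A = H k\<close> and \<open>n = N k\<close> are constants and the sample
  is a point of the product space \<open>P^n\<close>. Put \<open>g = gradient F X\<close> and \<open>v = A g\<close>. The upper Hessian bound
  gives, for the averaged direction \<open>w\<close>,
  \<open>F (X - \<alpha> w) \<le> F X - \<alpha> (g \<bullet> w) + L \<alpha>\<^sup>2 / 2 * |w|\<^sup>2\<close>. Here \<open>w\<close> has mean \<open>v\<close>, and by independence
  its second moment is \<open>|v|\<^sup>2\<close> plus \<open>1 / n\<close> times the variance of a single direction
  (\<open>second_moment_sample_mean\<close>). The two tests control this variance: one bounds its part along \<open>v\<close>, the
  other its part orthogonal to \<open>v\<close>, so that the second moment of \<open>w\<close> is at most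
  \<open>(1 + \<theta>\<^sup>2 + \<nu>\<^sup>2) |v|\<^sup>2\<close> (\<open>variance_le_of_tests\<close>). Since \<open>A\<^sup>2 \<preceq> \<Lambda>\<^sub>2 A\<close>, this is at most
  \<open>(1 + \<theta>\<^sup>2 + \<nu>\<^sup>2) \<Lambda>\<^sub>2 (g \<bullet> v)\<close>, and the bound on the steplength lets the quadratic term use up no more
  than half of the linear one. What remains is an expected decrease of at least
  \<open>\<alpha> / 2 * (g \<bullet> v) \<ge> \<alpha> \<Lambda>\<^sub>1 / 2 * |g|\<^sup>2 \<ge> \<mu> \<Lambda>\<^sub>1 \<alpha> (F X - F xstar)\<close>; the last step is the
  Polyak-Lojasiewicz inequality, a consequence of strong convexity (\<open>expected_decrease\<close>).

  Passing from the random process to the product space is the measure-theoretic half of the proof. On the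
  event \<open>N k = n\<close> the law of the pair (history, sample) is the product with \<open>P^n\<close> of the law of the history
  on that event (\<open>freeze_sample\<close>), because both measures agree on products of a history event with a box of data sets.
  Hence conditional expectations of functions of the history and one data point are integrals over \<open>P\<close> with
  the history held fixed (\<open>nn_cond_exp_data_point\<close>), and the hypotheses turn into statements about
  almost every history. For this the gradient of the loss has to be jointly measurable in the iterate and the
  data, which follows from continuity in the one and measurability in the other.

  Since the optimality gap is nonnegative, its integrals over histories are taken as extended nonnegative
  ones; its integrability then comes out of the same induction that yields the rate.
\<close>

section \<open>Gradients and second-order bounds\<close>

text \<open>
  A derivative on a Euclidean space is the inner product with a unique vector, whose coordinates are its
  values on the basis; hence the definite description in \<open>gradient\<close> denotes that vector.
\<close>

lemma gradient_GDERIV: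
  fixes \<phi> :: "'a::euclidean_space \<Rightarrow> real"
  assumes "\<phi> differentiable at x"
  shows "GDERIV \<phi> x :> gradient \<phi> x"
proof -
  obtain D where D: "(\<phi> has_derivative D) (at x)"
    using assms by (auto simp: differentiable_def)
  then interpret D: bounded_linear D
    by (rule has_derivative_bounded_linear)
  define g where "g = (\<Sum>b\<in>Basis. D b *\<^sub>R b)"
  have "D h = h \<bullet> g" for h
  proof -
    have "D h = D (\<Sum>b\<in>Basis. (h \<bullet> b) *\<^sub>R b)"
      by (simp add: euclidean_representation)
    also have "\<dots> = h \<bullet> g"
      by (simp add: g_def D.sum D.scaleR inner_sum_right mult.commute)
    finally show ?thesis .
  qed
  then have "GDERIV \<phi> x :> g"
    using D unfolding gderiv_def by (metis (no_types, lifting) ext)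
  moreover have "g' = g" if "GDERIV \<phi> x :> g'" for g'
  proof -
    have "(\<lambda>h. h \<bullet> g') = (\<lambda>h. h \<bullet> g)"
      using has_derivative_unique that \<open>GDERIV \<phi> x :> g\<close> unfolding gderiv_def by blast
    \<comment> \<open>evaluate both functionals at the difference of their representing vectors\<close>
    then have "(g' - g) \<bullet> g' = (g' - g) \<bullet> g"
      by metis
    then show ?thesis
      by (metis eq_iff_diff_eq_0 inner_diff_right inner_eq_zero_iff)
  qed
  ultimately show ?thesis
    unfolding gradient_def by (rule theI)
qed

lemma DERIV_along_line:
  fixes \<phi> :: "'a::euclidean_space \<Rightarrow> real"
  assumes "\<phi> differentiable at (y + t *\<^sub>R v)"
  shows "((\<lambda>t. \<phi> (y + t *\<^sub>R v)) has_real_derivative (v \<bullet> gradient \<phi> (y + t *\<^sub>R v))) (at t)"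
proof -
  have "((\<lambda>t. y + t *\<^sub>R v) has_derivative (\<lambda>s. s *\<^sub>R v)) (at t)"
    by (auto intro!: derivative_eq_intros)
  from has_derivative_compose[OF this gradient_GDERIV[OF assms, unfolded gderiv_def]]
  show ?thesis
    by (simp add: has_field_derivative_def mult_commute_abs)
qed

text \<open>
  Taylor's formula with Lagrange remainder for the restriction of \<open>F\<close> to the segment from \<open>y\<close> to \<open>y + v\<close>;
  \<open>u\<close> is the intermediate point.
\<close>

lemma second_order_Taylor:
  fixes F :: "real^'d \<Rightarrow> real"
  assumes "twice_continuously_differentiable F"
  obtains u where "F (y + v) = F y + v \<bullet> gradient F y + (v \<bullet> (hessian F u *v v)) / 2"
proof -
  let ?g = "gradient F"
  define \<phi> where "\<phi> m t = (if m = 0 then F (y + t *\<^sub>R v)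
      else if m = 1 then v \<bullet> ?g (y + t *\<^sub>R v)
      else v \<bullet> (hessian F (y + t *\<^sub>R v) *v v))" for m :: nat and t :: real
  have dF: "F differentiable at u" and dg: "?g differentiable at u" for u
    using assms by (auto simp: twice_continuously_differentiable_def)
  have D1: "DERIV (\<phi> 0) t :> \<phi> 1 t" for t
    using DERIV_along_line[OF dF] by (simp add: \<phi>_def[abs_def])
  have D2: "DERIV (\<phi> 1) t :> \<phi> 2 t" for t
  proof -
    let ?u = "y + t *\<^sub>R v"
    define D where "D = frechet_derivative ?g (at ?u)"
    have D: "(?g has_derivative D) (at ?u)"
      using dg frechet_derivative_works D_def by blast
    then have lin: "linear D"
      using has_derivative_bounded_linear bounded_linear.linear by blast
    have "((\<lambda>t. y + t *\<^sub>R v) has_derivative (\<lambda>s. s *\<^sub>R v)) (at t)"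
      by (auto intro!: derivative_eq_intros)
    from has_derivative_inner_right[OF has_derivative_compose[OF this D], of v]
    have "((\<lambda>t. v \<bullet> ?g (y + t *\<^sub>R v)) has_derivative (\<lambda>s. v \<bullet> D (s *\<^sub>R v))) (at t)" .
    moreover have "hessian F ?u *v v = D v"
      unfolding hessian_def D_def[symmetric] using lin by (simp add: matrix_works)
    ultimately show ?thesis
      by (simp add: \<phi>_def[abs_def] has_field_derivative_def linear_cmul[OF lin] mult_commute_abs)
  qed
  have "\<exists>t. 0 < t \<and> t \<le> 1 \<and>
      F (y + v) = (\<Sum>m<2. \<phi> m 0 / fact m * 1 ^ m) + \<phi> 2 t / fact 2 * 1 ^ 2"
  proof (rule Maclaurin2[of 1 \<phi> "\<lambda>t. F (y + t *\<^sub>R v)" 2, simplified scaleR_one])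
    show "\<forall>m t. m < 2 \<and> 0 \<le> t \<and> t \<le> 1 \<longrightarrow> DERIV (\<phi> m) t :> \<phi> (Suc m) t"
    proof (intro allI impI)
      fix m :: nat and t :: real assume "m < 2 \<and> 0 \<le> t \<and> t \<le> 1"
      then have "m = 0 \<or> m = 1" by auto
      then show "DERIV (\<phi> m) t :> \<phi> (Suc m) t"
        using D1 D2 by (auto simp: numeral_2_eq_2)
    qed
  qed (auto simp: \<phi>_def)
  then obtain t where "F (y + v) = (\<Sum>m<2. \<phi> m 0 / fact m * 1 ^ m) + \<phi> 2 t / fact 2 * 1 ^ 2"
    by blast
  then have "F (y + v) = F y + v \<bullet> ?g y + (v \<bullet> (hessian F (y + t *\<^sub>R v) *v v)) / 2"
    by (simp add: \<phi>_def numeral_2_eq_2)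
  then show ?thesis by (rule that)
qed

lemma loewner_le_quadratic_form:
  "A \<preceq> B \<Longrightarrow> v \<bullet> (A *v v) \<le> v \<bullet> (B *v v)"
  by (simp add: loewner_le_def pos_semidefinite_def matrix_vector_mult_diff_rdistrib inner_diff_right)

lemma quadratic_form_scaled_identity:
  fixes v :: "real^'d"
  shows "v \<bullet> ((c *\<^sub>R mat 1) *v v) = c * (norm v)\<^sup>2"
  by (simp add: scaleR_matrix_vector_assoc[symmetric] power2_norm_eq_inner)

lemma quadratic_bounds:
  fixes F :: "real^'d \<Rightarrow> real"
  assumes F: "twice_continuously_differentiable F"
    and hess: "\<And>y. \<mu> *\<^sub>R mat 1 \<preceq> hessian F y \<and> hessian F y \<preceq> L *\<^sub>R mat 1"
  shows "F y + v \<bullet> gradient F y + \<mu> / 2 * (norm v)\<^sup>2 \<le> F (y + v)"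
    and "F (y + v) \<le> F y + v \<bullet> gradient F y + L / 2 * (norm v)\<^sup>2"
proof -
  obtain u where "F (y + v) = F y + v \<bullet> gradient F y + (v \<bullet> (hessian F u *v v)) / 2"
    using second_order_Taylor[OF F] .
  moreover have "\<mu> * (norm v)\<^sup>2 \<le> v \<bullet> (hessian F u *v v)" "v \<bullet> (hessian F u *v v) \<le> L * (norm v)\<^sup>2"
    using hess[of u] loewner_le_quadratic_form[of _ _ v] quadratic_form_scaled_identity[of v]
    by metis+
  ultimately show "F y + v \<bullet> gradient F y + \<mu> / 2 * (norm v)\<^sup>2 \<le> F (y + v)"
    and "F (y + v) \<le> F y + v \<bullet> gradient F y + L / 2 * (norm v)\<^sup>2"
    by auto
qed

text \<open>
  Strong convexity bounds \<open>F z\<close> from below by a quadratic function of \<open>z - y\<close>; completing the square, the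
  smallest value of that quadratic is \<open>F y - |g|\<^sup>2 / (2 \<mu>)\<close>.
\<close>

lemma Polyak_Lojasiewicz:
  fixes F :: "'a::real_inner \<Rightarrow> real"
  assumes "0 < \<mu>" and lower: "\<And>v. F y + v \<bullet> g + \<mu> / 2 * (norm v)\<^sup>2 \<le> F (y + v)"
  shows "2 * \<mu> * (F y - F z) \<le> (norm g)\<^sup>2"
proof -
  let ?v = "z - y"
  have "0 \<le> (norm (\<mu> *\<^sub>R ?v + g))\<^sup>2" by simp
  also have "\<dots> = \<mu>\<^sup>2 * (norm ?v)\<^sup>2 + 2 * \<mu> * (?v \<bullet> g) + (norm g)\<^sup>2"
    unfolding power2_norm_eq_inner
    by (simp add: inner_add inner_commute power2_eq_square algebra_simps)
  finally have 1: "0 \<le> \<mu>\<^sup>2 * (norm ?v)\<^sup>2 + 2 * \<mu> * (?v \<bullet> g) + (norm g)\<^sup>2" .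
  have "2 * \<mu> * (F y + ?v \<bullet> g + \<mu> / 2 * (norm ?v)\<^sup>2) \<le> 2 * \<mu> * F z"
    using lower[of ?v] \<open>0 < \<mu>\<close> by simp
  with 1 show ?thesis
    by (simp add: algebra_simps power2_eq_square)
qed

section \<open>Quasi-Newton matrices and the splitting of the variance\<close>

text \<open>
  This is \<open>A\<^sup>2 \<preceq> c A\<close>, obtained without spectral theory by evaluating the form of \<open>A\<close> at \<open>c g - A g\<close>.
\<close>

lemma norm_mult_square_le:
  fixes A :: "real^'d^'d"
  assumes sym: "transpose A = A" and pos: "\<And>v. 0 \<le> v \<bullet> (A *v v)"
    and le: "A \<preceq> c *\<^sub>R mat 1" and "0 < c"
  shows "(norm (A *v g))\<^sup>2 \<le> c * (g \<bullet> (A *v g))"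
proof -
  let ?w = "A *v g"
  have swap: "g \<bullet> (A *v ?w) = ?w \<bullet> ?w"
    by (metis dot_lmul_matrix sym vector_transpose_matrix)
  have "0 \<le> (c *\<^sub>R g - ?w) \<bullet> (A *v (c *\<^sub>R g - ?w))"
    by (rule pos)
  also have "\<dots> = c\<^sup>2 * (g \<bullet> ?w) - 2 * c * (norm ?w)\<^sup>2 + ?w \<bullet> (A *v ?w)"
    unfolding power2_norm_eq_inner
    by (simp add: inner_diff swap power2_eq_square algebra_simps)
  also have "?w \<bullet> (A *v ?w) \<le> c * (norm ?w)\<^sup>2"
    using loewner_le_quadratic_form[OF le, of ?w] by (simp only: quadratic_form_scaled_identity)
  finally have "0 \<le> c * (c * (g \<bullet> ?w) - (norm ?w)\<^sup>2)"
    by (simp add: algebra_simps power2_eq_square)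
  with \<open>0 < c\<close> show ?thesis
    by (simp add: zero_le_mult_iff)
qed

text \<open>
  Pythagoras: \<open>w - v\<close> is split into its component along \<open>v\<close>, which is what the inner product test
  measures, and the component of \<open>w\<close> orthogonal to \<open>v\<close>, which is what the orthogonality condition measures.
\<close>

lemma norm_square_split_along:
  fixes v w :: "'a::real_inner"
  assumes "v \<noteq> 0"
  shows "(norm (w - v))\<^sup>2 = (v \<bullet> w - (norm v)\<^sup>2)\<^sup>2 / (norm v)\<^sup>2
    + (norm (w - ((w \<bullet> v) / (norm v)\<^sup>2) *\<^sub>R v))\<^sup>2"
  using assms
  by (simp add: power2_norm_eq_inner inner_diff inner_commute[of v w] divide_simps)
     (simp add: algebra_simps power2_eq_square)

section \<open>Measurable dependence of gradients on parameters\<close>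

lemma difference_quotients_along_line:
  fixes \<phi> :: "'a::euclidean_space \<Rightarrow> real"
  assumes D: "((\<lambda>t. \<phi> (y + t *\<^sub>R v)) has_real_derivative d) (at 0)"
  shows "(\<lambda>n. real (Suc n) * (\<phi> (y + (1 / real (Suc n)) *\<^sub>R v) - \<phi> y)) \<longlonglongrightarrow> d"
proof -
  have lim: "((\<lambda>h. (\<phi> (y + h *\<^sub>R v) - \<phi> y) / h) \<longlongrightarrow> d) (at 0)"
    using D unfolding DERIV_def by simp
  have "filterlim (\<lambda>n. 1 / real (Suc n)) (at 0) sequentially"
    unfolding filterlim_at using LIMSEQ_inverse_real_of_nat
    by (simp add: inverse_eq_divide del: of_nat_Suc)
  from filterlim_compose[OF lim this] show ?thesis
    by (simp add: field_simps)
qed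

text \<open>
  A function that is continuous in one variable and measurable in the other is jointly measurable: replacing
  the first variable by a simple function of it leaves finitely many measurable functions glued together, and
  continuity recovers the original function as the variable is approximated.
\<close>

lemma borel_measurable_Caratheodory:
  fixes f :: "'a::{metric_space, second_countable_topology} \<Rightarrow> 'p \<Rightarrow> real"
  assumes meas: "\<And>u. f u \<in> borel_measurable P"
    and cont: "\<And>p. p \<in> space P \<Longrightarrow> continuous_on UNIV (\<lambda>u. f u p)"
  shows "(\<lambda>(u, p). f u p) \<in> borel_measurable (borel \<Otimes>\<^sub>M P)"
proof -
  obtain s :: "nat \<Rightarrow> 'a \<Rightarrow> 'a" where s: "\<And>i. simple_function borel (s i)" "\<And>u. (\<lambda>i. s i u) \<longlonglongrightarrow> u"
    using borel_measurable_implies_sequence_metric[of "\<lambda>u::'a. u" borel undefined] by auto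
  have "(\<lambda>z. f (s i (fst z)) (snd z)) \<in> borel_measurable (borel \<Otimes>\<^sub>M P)" for i
  proof (rule measurable_compose_countable'[where I = "range (s i)"])
    show "(\<lambda>z. f c (snd z)) \<in> borel_measurable (borel \<Otimes>\<^sub>M P)" for c
      using meas by measurable
    have fin: "finite (range (s i))"
      using simple_functionD(1)[OF s(1), of i] by simp
    then show "countable (range (s i))"
      by (rule countable_finite)
    have "s i \<in> measurable borel (count_space (range (s i)))"
      using fin simple_functionD(2)[OF s(1), of i] by (auto simp: measurable_count_space_eq2)
    then show "(\<lambda>z. s i (fst z)) \<in> measurable (borel \<Otimes>\<^sub>M P) (count_space (range (s i)))"
      by measurable
  qed
  then have "(\<lambda>z. f (fst z) (snd z)) \<in> borel_measurable (borel \<Otimes>\<^sub>M P)"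
  proof (rule borel_measurable_LIMSEQ_metric)
    fix z :: "'a \<times> 'p" assume "z \<in> space (borel \<Otimes>\<^sub>M P)"
    then have "continuous_on UNIV (\<lambda>u. f u (snd z))"
      by (intro cont) (auto simp: space_pair_measure)
    then show "(\<lambda>i. f (s i (fst z)) (snd z)) \<longlonglongrightarrow> f (fst z) (snd z)"
      by (rule continuous_on_tendsto_compose[OF _ s(2)]) auto
  qed
  then show ?thesis
    by (simp add: case_prod_unfold)
qed

text \<open>
  Each coordinate of the gradient is a limit of difference quotients, and these are jointly measurable by
  the previous lemma.
\<close>

lemma borel_measurable_gradient_of_parametric:
  fixes f :: "'a::euclidean_space \<Rightarrow> 'p \<Rightarrow> real"
  assumes meas: "\<And>u. f u \<in> borel_measurable P"
    and diff: "\<And>u p. p \<in> space P \<Longrightarrow> (\<lambda>y. f y p) differentiable at u"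
  shows "(\<lambda>(u, p). gradient (\<lambda>y. f y p) u) \<in> borel_measurable (borel \<Otimes>\<^sub>M P)"
proof -
  have "continuous_on UNIV (\<lambda>u. f u p)" if "p \<in> space P" for p
    using diff[OF that] by (intro continuous_at_imp_continuous_on ballI differentiable_imp_continuous_within)
  from borel_measurable_Caratheodory[OF meas this]
  have f: "(\<lambda>(u, p). f u p) \<in> borel_measurable (borel \<Otimes>\<^sub>M P)" .
  have shifted: "(\<lambda>z. f (fst z + c) (snd z)) \<in> borel_measurable (borel \<Otimes>\<^sub>M P)" for c
  proof -
    have "(\<lambda>z. (fst z + c, snd z)) \<in> measurable (borel \<Otimes>\<^sub>M P) (borel \<Otimes>\<^sub>M P)"
      by measurable
    from measurable_compose[OF this f] show ?thesis
      by (simp add: case_prod_unfold)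
  qed
  have "(\<lambda>z. gradient (\<lambda>y. f y (snd z)) (fst z) \<bullet> b) \<in> borel_measurable (borel \<Otimes>\<^sub>M P)" for b
  proof (rule borel_measurable_LIMSEQ_metric)
    fix n
    show "(\<lambda>z. real (Suc n) * (f (fst z + (1 / real (Suc n)) *\<^sub>R b) (snd z) - f (fst z) (snd z)))
        \<in> borel_measurable (borel \<Otimes>\<^sub>M P)"
      using shifted[of 0] shifted[of "(1 / real (Suc n)) *\<^sub>R b"]
      by (intro borel_measurable_times borel_measurable_diff) auto
  next
    fix z :: "'a \<times> 'p" assume "z \<in> space (borel \<Otimes>\<^sub>M P)"
    then have "(\<lambda>y. f y (snd z)) differentiable at (fst z + 0 *\<^sub>R b)"
      by (intro diff) (auto simp: space_pair_measure)
    from difference_quotients_along_line[OF DERIV_along_line[OF this]]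
    show "(\<lambda>n. real (Suc n) * (f (fst z + (1 / real (Suc n)) *\<^sub>R b) (snd z) - f (fst z) (snd z)))
        \<longlonglongrightarrow> gradient (\<lambda>y. f y (snd z)) (fst z) \<bullet> b"
      by (simp add: inner_commute)
  qed
  then show ?thesis
    unfolding case_prod_unfold by (subst borel_measurable_euclidean_space) auto
qed

lemma borel_measurable_matrix_vector_mult:
  fixes A :: "'a \<Rightarrow> real^'m^'n" and u :: "'a \<Rightarrow> real^'m"
  assumes "A \<in> borel_measurable K" "u \<in> borel_measurable K"
  shows "(\<lambda>z. A z *v u z) \<in> borel_measurable K"
proof (rule borel_measurable_continuous_Pair[OF assms])
  show "continuous_on UNIV (\<lambda>z :: (real^'m^'n) \<times> (real^'m). fst z *v snd z)"
    unfolding matrix_vector_mult_def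
    by (intro continuous_on_vec_lambda continuous_intros)
qed

section \<open>Sample means of independent data\<close>

lemma integrable_square_imp_integrable:
  fixes W :: "'p \<Rightarrow> 'a::euclidean_space"
  assumes "finite_measure P" and [measurable]: "W \<in> borel_measurable P"
    and "integrable P (\<lambda>p. (norm (W p))\<^sup>2)"
  shows "integrable P W"
proof -
  interpret finite_measure P by fact
  have "integrable P (\<lambda>p. 1 + (norm (W p))\<^sup>2)"
    using assms by simp
  then show ?thesis
  proof (rule Bochner_Integration.integrable_bound)
    have "norm (W p) \<le> 1 + (norm (W p))\<^sup>2" for p
    proof -
      have "0 \<le> (norm (W p) - 1)\<^sup>2" by simp
      then show ?thesis
        unfolding power2_diff using norm_ge_zero[of "W p"] by (simp del: norm_ge_zero)
    qed
    then show "AE p in P. norm (W p) \<le> norm (1 + (norm (W p))\<^sup>2)"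
      by (auto intro!: AE_I2 simp: abs_of_nonneg add_nonneg_nonneg)
  qed simp
qed

context prob_space
begin

lemma component_integral:
  fixes W :: "'a \<Rightarrow> 'b::{banach, second_countable_topology}" and n :: nat
  assumes "i < n" and [measurable]: "W \<in> borel_measurable M"
  shows "integrable (Pi\<^sub>M {..<n} (\<lambda>_. M)) (\<lambda>q. W (q i)) \<longleftrightarrow> integrable M W"
    and "(\<integral>q. W (q i) \<partial>Pi\<^sub>M {..<n} (\<lambda>_. M)) = (\<integral>p. W p \<partial>M)"
proof -
  have D: "distr (Pi\<^sub>M {..<n} (\<lambda>_. M)) M (\<lambda>q. q i) = M"
    using \<open>i < n\<close> by (intro distr_PiM_component) (auto intro: prob_space_axioms)
  have [measurable]: "(\<lambda>q. q i) \<in> measurable (Pi\<^sub>M {..<n} (\<lambda>_. M)) M"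
    using \<open>i < n\<close> by simp
  show "integrable (Pi\<^sub>M {..<n} (\<lambda>_. M)) (\<lambda>q. W (q i)) \<longleftrightarrow> integrable M W"
    using integrable_distr_eq[of "\<lambda>q. q i" "Pi\<^sub>M {..<n} (\<lambda>_. M)" M W] by (simp add: D)
  show "(\<integral>q. W (q i) \<partial>Pi\<^sub>M {..<n} (\<lambda>_. M)) = (\<integral>p. W p \<partial>M)"
    using integral_distr[of "\<lambda>q. q i" "Pi\<^sub>M {..<n} (\<lambda>_. M)" M W] by (simp add: D)
qed

text \<open>
  Each of the products \<open>(U (q i) \<bullet> b) * (U (q j) \<bullet> b)\<close>, with \<open>b\<close> a basis vector, is a product of functions of
  single coordinates of \<open>q\<close>, so its integral factors, and the \<open>i\<close>-th factor vanishes.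
\<close>

lemma independent_components_uncorrelated:
  fixes U :: "'a \<Rightarrow> 'b::euclidean_space" and n :: nat
  assumes ij: "i < n" "j < n" "i \<noteq> j" and int: "integrable M U" and mean: "(\<integral>p. U p \<partial>M) = 0"
  shows "integrable (Pi\<^sub>M {..<n} (\<lambda>_. M)) (\<lambda>q. U (q i) \<bullet> U (q j))" (is "integrable ?Q _")
    and "(\<integral>q. U (q i) \<bullet> U (q j) \<partial>Pi\<^sub>M {..<n} (\<lambda>_. M)) = 0"
proof -
  interpret product_sigma_finite "\<lambda>_::nat. M"
    by unfold_locales
  \<comment> \<open>the factor belonging to coordinate \<open>k\<close>, which is \<open>1\<close> for all but two coordinates\<close>
  define \<phi> where "\<phi> b k p = (if k = i then U p \<bullet> b else 1) * (if k = j then U p \<bullet> b else 1)"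
    for b :: 'b and k p
  have \<phi>_int: "integrable M (\<phi> b k)" for b k
    using int ij by (cases "k = i"; cases "k = j") (auto simp: \<phi>_def[abs_def])
  have prod: "(\<Prod>k<n. \<phi> b k (q k)) = (U (q i) \<bullet> b) * (U (q j) \<bullet> b)" for b q
  proof -
    have "(\<Prod>k<n. if k = l then U (q k) \<bullet> b else 1) = U (q l) \<bullet> b" if "l < n" for l
      using that by (subst prod.delta) auto
    then show ?thesis
      using ij by (simp add: \<phi>_def prod.distrib)
  qed
  have "integral\<^sup>L M (\<phi> b i) = 0" for b
    using ij int mean by (simp add: \<phi>_def[abs_def])
  then have "(\<Prod>k<n. integral\<^sup>L M (\<phi> b k)) = 0" for b
    using ij by (intro prod_zero) auto
  then have b: "integrable ?Q (\<lambda>q. (U (q i) \<bullet> b) * (U (q j) \<bullet> b))"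
      "(\<integral>q. (U (q i) \<bullet> b) * (U (q j) \<bullet> b) \<partial>?Q) = 0" for b
    using product_integrable_prod[of "{..<n}" "\<phi> b"] product_integral_prod[of "{..<n}" "\<phi> b"] \<phi>_int
    by (simp_all add: prod)
  have eq: "U (q i) \<bullet> U (q j) = (\<Sum>b\<in>Basis. (U (q i) \<bullet> b) * (U (q j) \<bullet> b))" for q
    by (rule euclidean_inner)
  show "integrable ?Q (\<lambda>q. U (q i) \<bullet> U (q j))"
    unfolding eq using b(1) by auto
  show "(\<integral>q. U (q i) \<bullet> U (q j) \<partial>?Q) = 0"
    unfolding eq using b by (subst Bochner_Integration.integral_sum) auto
qed

text \<open>
  After centring, the square of the sum has only its \<open>n\<close> diagonal terms left in the mean, so averaging
  divides the variance by \<open>n\<close>.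
\<close>

lemma second_moment_sample_mean:
  fixes W :: "'a \<Rightarrow> 'b::euclidean_space"
  assumes "0 < n" and meas [measurable]: "W \<in> borel_measurable M"
    and sq: "integrable M (\<lambda>p. (norm (W p))\<^sup>2)" and mean: "(\<integral>p. W p \<partial>M) = v"
  defines "mW \<equiv> \<lambda>q. (1 / real n) *\<^sub>R (\<Sum>i<n. W (q i))"
  shows "integrable (Pi\<^sub>M {..<n} (\<lambda>_. M)) mW" (is "integrable ?Q _")
    and "(\<integral>q. mW q \<partial>Pi\<^sub>M {..<n} (\<lambda>_. M)) = v"
    and "integrable (Pi\<^sub>M {..<n} (\<lambda>_. M)) (\<lambda>q. (norm (mW q))\<^sup>2)"
    and "(\<integral>q. (norm (mW q))\<^sup>2 \<partial>Pi\<^sub>M {..<n} (\<lambda>_. M))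
      = (norm v)\<^sup>2 + (\<integral>p. (norm (W p - v))\<^sup>2 \<partial>M) / real n"
proof -
  interpret Q: prob_space ?Q
    by (rule prob_space_PiM) (rule prob_space_axioms)
  have W: "integrable M W"
    by (rule integrable_square_imp_integrable) (use sq in \<open>auto intro: finite_measure_axioms\<close>)
  show mW_int: "integrable ?Q mW"
    unfolding mW_def using component_integral(1)[of _ n W] W
    by (intro integrable_scaleR_right Bochner_Integration.integrable_sum) auto
  show mW_mean: "(\<integral>q. mW q \<partial>?Q) = v"
  proof -
    have "(\<integral>q. (\<Sum>i<n. W (q i)) \<partial>?Q) = (\<Sum>i<n. v)"
      using component_integral[of _ n W] W mean
      by (subst Bochner_Integration.integral_sum) auto
    then show ?thesis
      using \<open>0 < n\<close> by (simp add: mW_def sum_constant_scaleR)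
  qed
  define U where "U p = W p - v" for p
  have U_meas [measurable]: "U \<in> borel_measurable M"
    unfolding U_def by measurable
  have U: "integrable M U" "(\<integral>p. U p \<partial>M) = 0"
    using W mean unfolding U_def by (auto simp: prob_space)
  have U_norm: "(norm (U p))\<^sup>2 = (norm (W p))\<^sup>2 - 2 * (W p \<bullet> v) + (norm v)\<^sup>2" for p
    unfolding U_def power2_norm_eq_inner by (simp add: inner_diff inner_commute)
  have U_sq: "integrable M (\<lambda>p. U p \<bullet> U p)"
    unfolding power2_norm_eq_inner[symmetric] U_norm using sq W by auto
  define c where "c i j = (if i = j then \<integral>p. U p \<bullet> U p \<partial>M else 0)" for i j :: nat
  have c: "integrable ?Q (\<lambda>q. U (q i) \<bullet> U (q j))" "(\<integral>q. U (q i) \<bullet> U (q j) \<partial>?Q) = c i j"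
    if "i < n" "j < n" for i j
    using that independent_components_uncorrelated[OF that _ U] U_sq
      component_integral[of j n "\<lambda>p. U p \<bullet> U p"]
    by (cases "i = j"; auto simp: c_def)+
  have dev: "mW q - v = (1 / real n) *\<^sub>R (\<Sum>i<n. U (q i))" for q
    using \<open>0 < n\<close> by (simp add: mW_def U_def sum_subtractf scaleR_diff_right sum_constant_scaleR)
  have dev_sq: "(norm (mW q - v))\<^sup>2 = (1 / (real n)\<^sup>2) * (\<Sum>i<n. \<Sum>j<n. U (q i) \<bullet> U (q j))" for q
  proof -
    have "(norm (mW q - v))\<^sup>2
        = (1 / (real n)\<^sup>2) * ((\<Sum>i<n. U (q i)) \<bullet> (\<Sum>j<n. U (q j)))"
      unfolding dev power2_norm_eq_inner by (simp add: power2_eq_square)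
    then show ?thesis
      unfolding inner_sum_left unfolding inner_sum_right .
  qed
  have dev_int: "integrable ?Q (\<lambda>q. (norm (mW q - v))\<^sup>2)"
    unfolding dev_sq
    by (intro integrable_mult_right Bochner_Integration.integrable_sum c(1)) auto
  have "(\<integral>q. (\<Sum>i<n. \<Sum>j<n. U (q i) \<bullet> U (q j)) \<partial>?Q)
      = (\<Sum>i<n. \<integral>q. (\<Sum>j<n. U (q i) \<bullet> U (q j)) \<partial>?Q)"
    by (intro Bochner_Integration.integral_sum Bochner_Integration.integrable_sum c(1)) auto
  also have "\<dots> = (\<Sum>i<n. \<Sum>j<n. c i j)"
  proof (intro sum.cong refl)
    fix i assume "i \<in> {..<n}"
    then show "(\<integral>q. (\<Sum>j<n. U (q i) \<bullet> U (q j)) \<partial>?Q) = (\<Sum>j<n. c i j)"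
      by (subst Bochner_Integration.integral_sum) (auto intro!: sum.cong c)
  qed
  finally have "(\<integral>q. (norm (mW q - v))\<^sup>2 \<partial>?Q) = (1 / (real n)\<^sup>2) * (\<Sum>i<n. \<Sum>j<n. c i j)"
    unfolding dev_sq by (simp only: integral_mult_right_zero)
  also have "\<dots> = (\<integral>p. (norm (W p - v))\<^sup>2 \<partial>M) / real n"
    using \<open>0 < n\<close> unfolding c_def U_def power2_norm_eq_inner
    by (simp add: power2_eq_square)
  finally have dev_eq: "(\<integral>q. (norm (mW q - v))\<^sup>2 \<partial>?Q) = (\<integral>p. (norm (W p - v))\<^sup>2 \<partial>M) / real n" .
  have expand: "(norm (mW q))\<^sup>2 = (norm (mW q - v))\<^sup>2 + 2 * (mW q \<bullet> v) - (norm v)\<^sup>2" for q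
    unfolding power2_norm_eq_inner by (simp add: inner_diff inner_commute)
  show "integrable ?Q (\<lambda>q. (norm (mW q))\<^sup>2)"
    unfolding expand
    by (intro Bochner_Integration.integrable_add Bochner_Integration.integrable_diff dev_int
        integrable_mult_right integrable_inner_left mW_int) simp
  show "(\<integral>q. (norm (mW q))\<^sup>2 \<partial>?Q) = (norm v)\<^sup>2 + (\<integral>p. (norm (W p - v))\<^sup>2 \<partial>M) / real n"
  proof -
    have "(\<integral>q. (norm (mW q))\<^sup>2 \<partial>?Q)
        = (\<integral>q. (norm (mW q - v))\<^sup>2 \<partial>?Q) + (\<integral>q. 2 * (mW q \<bullet> v) \<partial>?Q) - (\<integral>q. (norm v)\<^sup>2 \<partial>?Q)"
      unfolding expand using dev_int mW_int
      by (subst Bochner_Integration.integral_diff Bochner_Integration.integral_add;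
          (intro Bochner_Integration.integrable_add integrable_mult_right integrable_inner_left)?; simp)+
    also have "(\<integral>q. 2 * (mW q \<bullet> v) \<partial>?Q) = 2 * (norm v)\<^sup>2"
      using mW_int by (simp add: mW_mean power2_norm_eq_inner)
    finally show ?thesis
      by (simp add: dev_eq Q.prob_space)
  qed
qed

end

section \<open>Expected decrease for a fixed history\<close>

text \<open>
  The two hypotheses bound the two terms of \<open>norm_square_split_along\<close>. For \<open>v = 0\<close> the projection is zero by
  convention and the orthogonality condition alone bounds the whole variance.
\<close>

lemma (in prob_space) variance_le_of_tests:
  fixes W :: "'a \<Rightarrow> 'b::euclidean_space"
  assumes "0 < n" and [measurable]: "W \<in> borel_measurable M"
    and sq: "integrable M (\<lambda>p. (norm (W p))\<^sup>2)"
    and inner: "(\<integral>p. (v \<bullet> W p - (norm v)\<^sup>2)\<^sup>2 \<partial>M) / real n \<le> \<theta>\<^sup>2 * norm v ^ 4"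
    and orth: "(\<integral>p. (norm (W p - ((W p \<bullet> v) / (norm v)\<^sup>2) *\<^sub>R v))\<^sup>2 \<partial>M) / real n
      \<le> \<nu>\<^sup>2 * (norm v)\<^sup>2"
  shows "(\<integral>p. (norm (W p - v))\<^sup>2 \<partial>M) / real n \<le> (\<theta>\<^sup>2 + \<nu>\<^sup>2) * (norm v)\<^sup>2"
proof (cases "v = 0")
  case True
  with orth show ?thesis by simp
next
  case False
  define a where "a p = (v \<bullet> W p - (norm v)\<^sup>2)\<^sup>2" for p
  define b where "b p = (norm (W p - ((W p \<bullet> v) / (norm v)\<^sup>2) *\<^sub>R v))\<^sup>2" for p
  have split: "(norm (W p - v))\<^sup>2 = a p / (norm v)\<^sup>2 + b p" for p
    unfolding a_def b_def by (rule norm_square_split_along[OF False])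
  have W: "integrable M W"
    by (rule integrable_square_imp_integrable) (use sq in \<open>auto intro: finite_measure_axioms\<close>)
  have "(norm (W p - v))\<^sup>2 = (norm (W p))\<^sup>2 - 2 * (W p \<bullet> v) + (norm v)\<^sup>2" for p
    unfolding power2_norm_eq_inner by (simp add: inner_diff inner_commute)
  then have dev: "integrable M (\<lambda>p. (norm (W p - v))\<^sup>2)"
    using sq W by simp
  have "integrable M (\<lambda>p. (norm v)\<^sup>2 * (norm (W p - v))\<^sup>2)"
    using dev by simp
  then have a: "integrable M a"
  proof (rule Bochner_Integration.integrable_bound)
    have "a p \<le> (norm v)\<^sup>2 * (norm (W p - v))\<^sup>2" for p
    proof -
      have "a p = (v \<bullet> (W p - v))\<^sup>2"
        by (simp add: a_def inner_diff_right power2_norm_eq_inner)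
      also have "\<dots> \<le> (norm v)\<^sup>2 * (norm (W p - v))\<^sup>2"
        using Cauchy_Schwarz_ineq[of v "W p - v"] by (simp add: power2_norm_eq_inner)
      finally show ?thesis .
    qed
    then show "AE p in M. norm (a p) \<le> norm ((norm v)\<^sup>2 * (norm (W p - v))\<^sup>2)"
      by (intro AE_I2) (simp add: a_def)
  qed (simp add: a_def[abs_def])
  have "b = (\<lambda>p. (norm (W p - v))\<^sup>2 - a p / (norm v)\<^sup>2)"
    using split by auto
  then have b: "integrable M b"
    using dev a by simp
  have "(\<integral>p. (norm (W p - v))\<^sup>2 \<partial>M) / real n
      = (\<integral>p. a p \<partial>M) / real n / (norm v)\<^sup>2 + (\<integral>p. b p \<partial>M) / real n"
    unfolding split using a b by (simp add: add_divide_distrib)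
  also have "\<dots> \<le> \<theta>\<^sup>2 * norm v ^ 4 / (norm v)\<^sup>2 + \<nu>\<^sup>2 * (norm v)\<^sup>2"
    using inner orth unfolding a_def b_def by (intro add_mono divide_right_mono) auto
  also have "\<dots> = (\<theta>\<^sup>2 + \<nu>\<^sup>2) * (norm v)\<^sup>2"
    using False by (simp add: field_simps power2_eq_square power4_eq_xxxx)
  finally show ?thesis .
qed

text \<open>
  One step of the method from the point \<open>X\<close> with matrix \<open>A\<close>, where \<open>h p\<close> is the stochastic gradient at the
  data point \<open>p\<close>. The integral is an extended nonnegative one, so that the estimate can later be integrated
  over histories by monotonicity alone.
\<close>

lemma (in prob_space) expected_decrease:
  fixes F :: "real^'d \<Rightarrow> real" and h :: "'a \<Rightarrow> real^'d" and X :: "real^'d" and A :: "real^'d^'d"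
  assumes "0 < n" and [measurable]: "h \<in> borel_measurable M"
    and sq: "integrable M (\<lambda>p. (norm (h p))\<^sup>2)" and mean: "(\<integral>p. h p \<partial>M) = g"
    and lower: "\<And>v. F X + v \<bullet> g + \<mu> / 2 * (norm v)\<^sup>2 \<le> F (X + v)"
    and upper: "\<And>v. F (X + v) \<le> F X + v \<bullet> g + L / 2 * (norm v)\<^sup>2"
    and min: "\<And>y. F z \<le> F y"
    and A: "pos_definite A" "\<Lambda>\<^sub>1 *\<^sub>R mat 1 \<preceq> A" "A \<preceq> \<Lambda>\<^sub>2 *\<^sub>R mat 1"
    and pos: "0 < \<mu>" "0 < L" "0 < \<Lambda>\<^sub>1" "0 < \<Lambda>\<^sub>2" "0 < \<alpha>"
    and step: "\<alpha> \<le> 1 / ((1 + \<theta>\<^sup>2 + \<nu>\<^sup>2) * L * \<Lambda>\<^sub>2)"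
    and inner: "(\<integral>p. ((A *v g) \<bullet> (A *v h p) - (norm (A *v g))\<^sup>2)\<^sup>2 \<partial>M) / real n
      \<le> \<theta>\<^sup>2 * norm (A *v g) ^ 4"
    and orth: "(\<integral>p. (norm (A *v h p - (((A *v h p) \<bullet> (A *v g)) / (norm (A *v g))\<^sup>2)
      *\<^sub>R (A *v g)))\<^sup>2 \<partial>M) / real n \<le> \<nu>\<^sup>2 * (norm (A *v g))\<^sup>2"
  shows "(\<integral>\<^sup>+q. ennreal (F (X - \<alpha> *\<^sub>R (A *v ((1 / real n) *\<^sub>R (\<Sum>i<n. h (q i))))) - F z)
      \<partial>Pi\<^sub>M {..<n} (\<lambda>_. M)) \<le> ennreal ((1 - \<mu> * \<Lambda>\<^sub>1 * \<alpha>) * (F X - F z))"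
proof -
  let ?Q = "Pi\<^sub>M {..<n} (\<lambda>_. M)"
  interpret Q: prob_space ?Q
    by (rule prob_space_PiM) (rule prob_space_axioms)
  define v where "v = A *v g"
  define W where "W p = A *v h p" for p
  define mW where "mW q = (1 / real n) *\<^sub>R (\<Sum>i<n. W (q i))" for q
  have lin: "bounded_linear ((*v) A)"
    by (simp add: matrix_vector_mul_bounded_linear)
  have [measurable]: "(*v) A \<in> borel_measurable borel"
    by (intro borel_measurable_continuous_onI linear_continuous_on lin)
  have W_meas [measurable]: "W \<in> borel_measurable M"
    unfolding W_def by measurable
  have h: "integrable M h"
    by (rule integrable_square_imp_integrable) (use sq in \<open>auto intro: finite_measure_axioms\<close>)
  have W_mean: "(\<integral>p. W p \<partial>M) = v"
    unfolding W_def v_def mean[symmetric] by (rule integral_bounded_linear[OF lin h])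
  obtain K where K: "\<And>u. norm (A *v u) \<le> norm u * K"
    using bounded_linear.bounded[OF lin] by blast
  have W_sq: "integrable M (\<lambda>p. (norm (W p))\<^sup>2)"
  proof (rule Bochner_Integration.integrable_bound)
    show "integrable M (\<lambda>p. K\<^sup>2 * (norm (h p))\<^sup>2)"
      using sq by simp
    have "(norm (W p))\<^sup>2 \<le> (norm (h p) * K)\<^sup>2" for p
      using K[of "h p"] by (intro power_mono) (auto simp: W_def)
    then show "AE p in M. norm ((norm (W p))\<^sup>2) \<le> norm (K\<^sup>2 * (norm (h p))\<^sup>2)"
      by (intro AE_I2) (simp add: power_mult_distrib mult.commute)
  qed measurable
  note moments = second_moment_sample_mean[OF \<open>0 < n\<close> W_meas W_sq W_mean, folded mW_def]
  have var: "(\<integral>p. (norm (W p - v))\<^sup>2 \<partial>M) / real n \<le> (\<theta>\<^sup>2 + \<nu>\<^sup>2) * (norm v)\<^sup>2"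
    using variance_le_of_tests[OF \<open>0 < n\<close> W_meas W_sq] inner orth unfolding v_def W_def by blast
  have mean_step: "A *v ((1 / real n) *\<^sub>R (\<Sum>i<n. h (q i))) = mW q" for q
    unfolding mW_def W_def
    by (simp add: matrix_vector_mult_scaleR linear_sum[OF matrix_vector_mul_linear])
  \<comment> \<open>the smoothness bound on the next optimality gap; unlike the gap itself it is a polynomial in
    \<open>mW q\<close>, so its integral is known exactly\<close>
  define r where "r q = F X - F z - \<alpha> * (mW q \<bullet> g) + L * \<alpha>\<^sup>2 / 2 * (norm (mW q))\<^sup>2" for q
  have F_le_r: "F (X - \<alpha> *\<^sub>R mW q) - F z \<le> r q" for q
    using upper[of "- (\<alpha> *\<^sub>R mW q)"] by (simp add: r_def power_mult_distrib)
  have r_nonneg: "0 \<le> r q" for q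
    using F_le_r[of q] min[of "X - \<alpha> *\<^sub>R mW q"] by linarith
  have r_int: "integrable ?Q r"
    unfolding r_def using moments(1,3)
    by (intro Bochner_Integration.integrable_add Bochner_Integration.integrable_diff
        integrable_mult_right integrable_inner_left) auto
  have r_mean: "(\<integral>q. r q \<partial>?Q) = F X - F z - \<alpha> * (v \<bullet> g)
      + L * \<alpha>\<^sup>2 / 2 * ((norm v)\<^sup>2 + (\<integral>p. (norm (W p - v))\<^sup>2 \<partial>M) / real n)"
    unfolding r_def using moments by (simp add: Q.prob_space)
  have gv: "\<Lambda>\<^sub>1 * (norm g)\<^sup>2 \<le> v \<bullet> g"
    using loewner_le_quadratic_form[OF A(2), of g] quadratic_form_scaled_identity[of g]
    by (metis inner_commute v_def)
  have vv: "(norm v)\<^sup>2 \<le> \<Lambda>\<^sub>2 * (v \<bullet> g)"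
  proof -
    have "0 \<le> u \<bullet> (A *v u)" for u
      using A(1) by (cases "u = 0") (auto simp: pos_definite_def less_imp_le)
    then show ?thesis
      using norm_mult_square_le[of A \<Lambda>\<^sub>2 g] A pos by (simp add: v_def pos_definite_def inner_commute)
  qed
  let ?c = "1 + \<theta>\<^sup>2 + \<nu>\<^sup>2"
  have c: "0 < ?c"
    by (intro add_pos_nonneg) auto
  \<comment> \<open>the upper bound on the steplength, in the form that absorbs half of the linear decrease\<close>
  have \<alpha>c: "L * \<alpha> * (?c * \<Lambda>\<^sub>2) \<le> 1"
  proof -
    have "0 < ?c * L * \<Lambda>\<^sub>2"
      using c pos by simp
    then have "\<alpha> * (?c * L * \<Lambda>\<^sub>2) \<le> 1"
      using step by (simp only: pos_le_divide_eq)
    then show ?thesis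
      by (simp add: algebra_simps)
  qed
  have vg_nonneg: "0 \<le> v \<bullet> g"
    using gv pos by (meson mult_nonneg_nonneg order_trans less_imp_le zero_le_power2)
  have "(norm v)\<^sup>2 + (\<integral>p. (norm (W p - v))\<^sup>2 \<partial>M) / real n \<le> ?c * (norm v)\<^sup>2"
    using var by (simp add: algebra_simps)
  also have "\<dots> \<le> ?c * (\<Lambda>\<^sub>2 * (v \<bullet> g))"
    using vv c by simp
  finally have "L * \<alpha>\<^sup>2 / 2 * ((norm v)\<^sup>2 + (\<integral>p. (norm (W p - v))\<^sup>2 \<partial>M) / real n)
      \<le> L * \<alpha>\<^sup>2 / 2 * (?c * (\<Lambda>\<^sub>2 * (v \<bullet> g)))"
    using pos by (intro mult_left_mono) auto
  also have "\<dots> = (L * \<alpha> * (?c * \<Lambda>\<^sub>2)) * (\<alpha> / 2 * (v \<bullet> g))"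
    by (simp add: power2_eq_square)
  also have "\<dots> \<le> 1 * (\<alpha> / 2 * (v \<bullet> g))"
    using \<alpha>c vg_nonneg pos by (intro mult_right_mono) auto
  finally have "(\<integral>q. r q \<partial>?Q) \<le> F X - F z - \<alpha> / 2 * (v \<bullet> g)"
    unfolding r_mean by linarith
  also have "\<dots> \<le> F X - F z - \<alpha> / 2 * (\<Lambda>\<^sub>1 * (2 * \<mu> * (F X - F z)))"
  proof -
    have "\<Lambda>\<^sub>1 * (2 * \<mu> * (F X - F z)) \<le> v \<bullet> g"
      using Polyak_Lojasiewicz[OF \<open>0 < \<mu>\<close> lower, of z] gv \<open>0 < \<Lambda>\<^sub>1\<close>
      by (meson mult_left_mono order_trans less_imp_le)
    then show ?thesis
      using \<open>0 < \<alpha>\<close> by (intro diff_left_mono mult_left_mono) auto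
  qed
  finally have r_le: "(\<integral>q. r q \<partial>?Q) \<le> (1 - \<mu> * \<Lambda>\<^sub>1 * \<alpha>) * (F X - F z)"
    by (simp add: algebra_simps)
  have "(\<integral>\<^sup>+q. ennreal (F (X - \<alpha> *\<^sub>R mW q) - F z) \<partial>?Q) \<le> (\<integral>\<^sup>+q. ennreal (r q) \<partial>?Q)"
    by (intro nn_integral_mono ennreal_leI F_le_r)
  also have "\<dots> = ennreal (\<integral>q. r q \<partial>?Q)"
    by (intro nn_integral_eq_integral r_int AE_I2 r_nonneg)
  also have "\<dots> \<le> ennreal ((1 - \<mu> * \<Lambda>\<^sub>1 * \<alpha>) * (F X - F z))"
    by (intro ennreal_leI r_le)
  finally show ?thesis
    unfolding mean_step .
qed

section \<open>Freezing the history\<close>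

lemma nn_integral_partition_nat:
  assumes N [measurable]: "N \<in> measurable M (count_space (UNIV :: nat set))"
    and [measurable]: "\<phi> \<in> borel_measurable M"
  shows "(\<integral>\<^sup>+\<omega>. \<phi> \<omega> \<partial>M) = (\<Sum>n. \<integral>\<^sup>+\<omega>. indicator {\<omega>. N \<omega> = n} \<omega> * \<phi> \<omega> \<partial>M)"
proof -
  have "(\<integral>\<^sup>+\<omega>. \<phi> \<omega> \<partial>M) = (\<integral>\<^sup>+\<omega>. (\<Sum>n. indicator {\<omega>. N \<omega> = n} \<omega> * \<phi> \<omega>) \<partial>M)"
  proof (intro nn_integral_cong)
    fix \<omega>
    have "(\<Sum>n. indicator {\<omega>. N \<omega> = n} \<omega> * \<phi> \<omega>) = indicator {\<omega>'. N \<omega>' = N \<omega>} \<omega> * \<phi> \<omega>"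
      by (subst suminf_finite[of "{N \<omega>}"]) (auto simp: indicator_def)
    then show "\<phi> \<omega> = (\<Sum>n. indicator {\<omega>. N \<omega> = n} \<omega> * \<phi> \<omega>)"
      by simp
  qed
  also have "\<dots> = (\<Sum>n. \<integral>\<^sup>+\<omega>. indicator {\<omega>. N \<omega> = n} \<omega> * \<phi> \<omega> \<partial>M)"
  proof (rule nn_integral_suminf)
    fix n
    have "(\<lambda>\<omega>. indicator {m. m = n} (N \<omega>) * \<phi> \<omega> :: ennreal) \<in> borel_measurable M"
      by measurable
    then show "(\<lambda>\<omega>. indicator {\<omega>. N \<omega> = n} \<omega> * \<phi> \<omega>) \<in> borel_measurable M"
      by (simp add: indicator_def)
  qed
  finally show ?thesis .
qed

context stochastic_quasi_newton
begin

lemma history_measurable: "g \<in> measurable (G k) K \<Longrightarrow> g \<in> measurable M K"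
  using measurable_from_subalg[OF history_subalgebra] .

lemma space_history: "space (G k) = space M" and sets_history: "C \<in> sets (G k) \<Longrightarrow> C \<in> sets M"
  using history_subalgebra[of k] by (auto simp: subalgebra_def)

lemma data_measurable: "\<xi> k i \<in> measurable M P"
  using history_measurable[OF sample_history] .

lemma N_measurable: "N k \<in> measurable M (count_space UNIV)"
  using history_measurable[OF N_history] .

lemma sample_measurable: "(\<lambda>\<omega>. \<lambda>i\<in>{..<n}. \<xi> k i \<omega>) \<in> measurable M (Pi\<^sub>M {..<n} (\<lambda>_. P))"
  by (intro measurable_restrict data_measurable)

text \<open>
  The sampling law, integrated over a history event. The law speaks of a sample of random size; intersecting
  with \<open>N k = n\<close>, itself a history event, makes the number of factors constant.
\<close>

lemma sample_box_law:
  assumes C: "C \<in> sets (G k)" and B: "\<And>i. B i \<in> sets P"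
  shows "emeasure M {\<omega> \<in> C. N k \<omega> = n \<and> (\<forall>i<n. \<xi> k i \<omega> \<in> B i)}
    = emeasure M {\<omega> \<in> C. N k \<omega> = n} * (\<Prod>i<n. emeasure P (B i))"
proof -
  interpret P: prob_space P by (rule prob_space_P)
  interpret sub: finite_measure_subalgebra M "G k"
    by unfold_locales (rule history_subalgebra)
  note [measurable] = data_measurable N_measurable
  let ?S = "{\<omega> \<in> space M. \<forall>i<N k \<omega>. \<xi> k i \<omega> \<in> B i}"
  let ?D = "{\<omega> \<in> C. N k \<omega> = n}"
  have C_space: "C \<subseteq> space M"
    using sets.sets_into_space[OF sets_history[OF C]] .
  have D: "?D \<in> sets (G k)"
  proof -
    have "N k -` {n} \<inter> space (G k) \<in> sets (G k)"
      by (rule measurable_sets[OF N_history]) simp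
    moreover have "?D = C \<inter> (N k -` {n} \<inter> space (G k))"
      using C_space by (auto simp: space_history)
    ultimately show ?thesis
      using C by auto
  qed
  \<comment> \<open>although \<open>N k\<close> bounds the quantifier, the event is measurable, as a countable union over its values\<close>
  have S: "?S \<in> sets M"
  proof -
    have "{\<omega> \<in> space M. N k \<omega> = m \<and> (\<forall>i<m. \<xi> k i \<omega> \<in> B i)} \<in> sets M" for m
      using B by measurable
    then have "(\<Union>m. {\<omega> \<in> space M. N k \<omega> = m \<and> (\<forall>i<m. \<xi> k i \<omega> \<in> B i)}) \<in> sets M"
      by blast
    moreover have "(\<Union>m. {\<omega> \<in> space M. N k \<omega> = m \<and> (\<forall>i<m. \<xi> k i \<omega> \<in> B i)}) = ?S"
      by auto
    ultimately show ?thesis by simp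
  qed
  have "measure M (?D \<inter> ?S) = (\<integral>\<omega>\<in>?D. indicator ?S \<omega> \<partial>M)"
    using sets_history[OF D] S
    by (simp add: set_lebesgue_integral_def indicator_inter_arith[symmetric])
  also have "\<dots> = (\<integral>\<omega>\<in>?D. real_cond_exp M (G k) (indicator ?S) \<omega> \<partial>M)"
    using S D by (intro sub.real_cond_exp_intA integrable_real_indicator) (auto simp: less_top[symmetric])
  also have "\<dots> = (\<integral>\<omega>\<in>?D. (\<Prod>i<n. measure P (B i)) \<partial>M)"
    unfolding set_lebesgue_integral_def
  proof (rule integral_cong_AE)
    show "AE \<omega> in M. indicat_real ?D \<omega> *\<^sub>R real_cond_exp M (G k) (indicator ?S) \<omega>
        = indicat_real ?D \<omega> *\<^sub>R (\<Prod>i<n. measure P (B i))"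
      using sample_law[OF B, of k] by eventually_elim (auto simp: indicator_def)
  qed (use sets_history[OF D] in auto)
  also have "\<dots> = measure M ?D * (\<Prod>i<n. measure P (B i))"
    using sets_history[OF D] by (simp add: set_lebesgue_integral_def)
  finally have "measure M (?D \<inter> ?S) = measure M ?D * (\<Prod>i<n. measure P (B i))" .
  moreover have "?D \<inter> ?S = {\<omega> \<in> C. N k \<omega> = n \<and> (\<forall>i<n. \<xi> k i \<omega> \<in> B i)}"
    using C_space by auto
  ultimately show ?thesis
    by (simp add: emeasure_eq_measure P.emeasure_eq_measure ennreal_mult prod_nonneg prod_ennreal)
qed

text \<open>
  Boxes form an intersection-stable generator of the product \<open>\<sigma>\<close>-algebra, so the law on boxes determines the law
  on all sample events.
\<close>

lemma sample_product_law:
  assumes C: "C \<in> sets (G k)" and E: "E \<in> sets (Pi\<^sub>M {..<n} (\<lambda>_. P))"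
  shows "emeasure M {\<omega> \<in> C. N k \<omega> = n \<and> (\<lambda>i\<in>{..<n}. \<xi> k i \<omega>) \<in> E}
    = emeasure M {\<omega> \<in> C. N k \<omega> = n} * emeasure (Pi\<^sub>M {..<n} (\<lambda>_. P)) E"
proof -
  interpret P: prob_space P by (rule prob_space_P)
  interpret PP: product_sigma_finite "\<lambda>_::nat. P" by unfold_locales
  note [measurable] = N_measurable sets_history[OF C] sample_measurable
  let ?Q = "Pi\<^sub>M {..<n} (\<lambda>_. P)"
  let ?s = "\<lambda>\<omega>. \<lambda>i\<in>{..<n}. \<xi> k i \<omega>"
  define D where "D = {\<omega> \<in> C. N k \<omega> = n}"
  have C_space: "C \<subseteq> space M"
    using sets.sets_into_space[OF sets_history[OF C]] .
  have [measurable]: "D \<in> sets M"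
  proof -
    have "D = C \<inter> {\<omega> \<in> space M. N k \<omega> = n}"
      using C_space by (auto simp: D_def)
    also have "\<dots> \<in> sets M" by measurable
    finally show ?thesis .
  qed
  have law: "emeasure (distr (density M (indicator D)) ?Q ?s) Y
      = emeasure M {\<omega> \<in> C. N k \<omega> = n \<and> ?s \<omega> \<in> Y}" if "Y \<in> sets ?Q" for Y
  proof -
    have "?s -` Y \<inter> space M \<in> sets M"
      using sample_measurable that by (rule measurable_sets)
    then have "emeasure (distr (density M (indicator D)) ?Q ?s) Y = emeasure M (D \<inter> (?s -` Y \<inter> space M))"
      using that by (simp add: emeasure_distr emeasure_restricted)
    also have "D \<inter> (?s -` Y \<inter> space M) = {\<omega> \<in> C. N k \<omega> = n \<and> ?s \<omega> \<in> Y}"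
      using C_space by (auto simp: D_def)
    finally show ?thesis .
  qed
  have "distr (density M (indicator D)) ?Q ?s = scale_measure (emeasure M D) ?Q"
  proof (rule measure_eqI_PiM_finite[where A = "\<lambda>_. \<Pi>\<^sub>E i\<in>{..<n}. space P"])
    fix B assume B: "\<And>i. i \<in> {..<n} \<Longrightarrow> B i \<in> sets P"
    \<comment> \<open>the sampling law asks for a measurable set at every index\<close>
    define B' where "B' i = (if i < n then B i else {})" for i
    have B': "B' i \<in> sets P" for i
      using B by (simp add: B'_def)
    have "Pi\<^sub>E {..<n} B \<in> sets ?Q"
      using B by (intro sets_PiM_I_finite) auto
    from law[OF this] have "emeasure (distr (density M (indicator D)) ?Q ?s) (Pi\<^sub>E {..<n} B)
        = emeasure M {\<omega> \<in> C. N k \<omega> = n \<and> (\<forall>i<n. \<xi> k i \<omega> \<in> B' i)}"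
      by (simp add: PiE_iff B'_def Ball_def)
    also have "\<dots> = emeasure M D * (\<Prod>i<n. emeasure P (B' i))"
      unfolding D_def by (rule sample_box_law[OF C B'])
    also have "\<dots> = emeasure (scale_measure (emeasure M D) ?Q) (Pi\<^sub>E {..<n} B)"
      using B by (simp add: B'_def) (subst PP.emeasure_PiM, auto)
    finally show "emeasure (distr (density M (indicator D)) ?Q ?s) (Pi\<^sub>E {..<n} B)
        = emeasure (scale_measure (emeasure M D) ?Q) (Pi\<^sub>E {..<n} B)" .
  next
    have "(\<Pi>\<^sub>E i\<in>{..<n}. space P) \<in> sets ?Q"
      by (intro sets_PiM_I_finite) auto
    then show "emeasure (distr (density M (indicator D)) ?Q ?s) (\<Pi>\<^sub>E i\<in>{..<n}. space P) \<noteq> \<infinity>"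
      unfolding law[OF \<open>(\<Pi>\<^sub>E i\<in>{..<n}. space P) \<in> sets ?Q\<close>] by (simp add: emeasure_eq_measure)
  qed (auto simp: space_PiM intro!: prod_algebraI_finite)
  then have "emeasure (distr (density M (indicator D)) ?Q ?s) E = emeasure M D * emeasure ?Q E"
    by simp
  with law[OF E] show ?thesis
    by (simp add: D_def)
qed

text \<open>
  Given the history, the sample is integrated as an independent point of the product space. The two
  joint measures coincide on rectangles, by the previous lemma, and hence everywhere; the rest is Tonelli.
\<close>

lemma freeze_sample:
  assumes \<psi>: "\<psi> \<in> borel_measurable (G k \<Otimes>\<^sub>M Pi\<^sub>M {..<n} (\<lambda>_. P))"
  shows "(\<integral>\<^sup>+\<omega>. indicator {\<omega>. N k \<omega> = n} \<omega> * \<psi> (\<omega>, \<lambda>i\<in>{..<n}. \<xi> k i \<omega>) \<partial>M)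
    = (\<integral>\<^sup>+\<omega>. indicator {\<omega>. N k \<omega> = n} \<omega> * (\<integral>\<^sup>+q. \<psi> (\<omega>, q) \<partial>Pi\<^sub>M {..<n} (\<lambda>_. P)) \<partial>M)"
proof -
  interpret P: prob_space P by (rule prob_space_P)
  let ?Q = "Pi\<^sub>M {..<n} (\<lambda>_. P)"
  interpret Q: prob_space ?Q
    by (rule prob_space_PiM) (rule P.prob_space_axioms)
  let ?s = "\<lambda>\<omega>. \<lambda>i\<in>{..<n}. \<xi> k i \<omega>"
  note [measurable] = N_measurable sample_measurable
  define A where "A = {\<omega> \<in> space M. N k \<omega> = n}"
  have A [measurable]: "A \<in> sets M"
    unfolding A_def by measurable
  let ?D = "density M (indicator A)"
  have [measurable]: "(\<lambda>\<omega>. \<omega>) \<in> measurable M (G k)"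
    by (rule history_measurable[of "\<lambda>\<omega>. \<omega>" k]) simp
  have T [measurable]: "(\<lambda>\<omega>. (\<omega>, ?s \<omega>)) \<in> measurable M (G k \<Otimes>\<^sub>M ?Q)"
    by measurable
  let ?J = "distr ?D (G k \<Otimes>\<^sub>M ?Q) (\<lambda>\<omega>. (\<omega>, ?s \<omega>))"
  have J: "distr ?D (G k) (\<lambda>\<omega>. \<omega>) \<Otimes>\<^sub>M ?Q = ?J"
  proof (rule pair_measure_eqI)
    have "finite_measure (distr ?D (G k) (\<lambda>\<omega>. \<omega>))"
      by (intro finite_measureI) (simp add: emeasure_distr emeasure_restricted)
    then show "sigma_finite_measure (distr ?D (G k) (\<lambda>\<omega>. \<omega>))"
      by (simp add: finite_measure_def)
    show "sigma_finite_measure ?Q" by unfold_locales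
  next
    fix C E assume "C \<in> sets (distr ?D (G k) (\<lambda>\<omega>. \<omega>))" and E: "E \<in> sets ?Q"
    then have C: "C \<in> sets (G k)" by simp
    note [measurable] = sets_history[OF C] E
    have C_space: "C \<subseteq> space M"
      using sets.sets_into_space[OF sets_history[OF C]] .
    have "emeasure (distr ?D (G k) (\<lambda>\<omega>. \<omega>)) C = emeasure M {\<omega> \<in> C. N k \<omega> = n}"
    proof -
      have "A \<inter> (C \<inter> space M) = {\<omega> \<in> C. N k \<omega> = n}"
        using C_space by (auto simp: A_def)
      then show ?thesis
        using C by (simp add: emeasure_distr emeasure_restricted)
    qed
    moreover have "emeasure ?J (C \<times> E) = emeasure M {\<omega> \<in> C. N k \<omega> = n \<and> ?s \<omega> \<in> E}"
    proof -
      have CE: "C \<times> E \<in> sets (G k \<Otimes>\<^sub>M ?Q)"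
        using C E by simp
      have "A \<inter> ((\<lambda>\<omega>. (\<omega>, ?s \<omega>)) -` (C \<times> E) \<inter> space M) = {\<omega> \<in> C. N k \<omega> = n \<and> ?s \<omega> \<in> E}"
        using C_space by (auto simp: A_def)
      then show ?thesis
        using measurable_sets[OF T CE] CE by (simp add: emeasure_distr emeasure_restricted)
    qed
    ultimately show "emeasure (distr ?D (G k) (\<lambda>\<omega>. \<omega>)) C * emeasure ?Q E = emeasure ?J (C \<times> E)"
      using sample_product_law[OF C E] by simp
  next
    show "sets (distr ?D (G k) (\<lambda>\<omega>. \<omega>) \<Otimes>\<^sub>M ?Q) = sets ?J"
      unfolding sets_distr by (rule sets_pair_measure_cong) simp_all
  qed
  have inner [measurable]: "(\<lambda>\<omega>. \<integral>\<^sup>+q. \<psi> (\<omega>, q) \<partial>?Q) \<in> borel_measurable (G k)"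
    using \<psi> by (intro Q.borel_measurable_nn_integral) simp
  have "(\<integral>\<^sup>+\<omega>. indicator A \<omega> * \<psi> (\<omega>, ?s \<omega>) \<partial>M) = (\<integral>\<^sup>+z. \<psi> z \<partial>?J)"
    using \<psi> by (simp add: nn_integral_distr nn_integral_density)
  also have "\<dots> = (\<integral>\<^sup>+\<omega>. \<integral>\<^sup>+q. \<psi> (\<omega>, q) \<partial>?Q \<partial>distr ?D (G k) (\<lambda>\<omega>. \<omega>))"
    unfolding J[symmetric] using \<psi> by (intro Q.nn_integral_fst[symmetric]) simp
  also have "\<dots> = (\<integral>\<^sup>+\<omega>. indicator A \<omega> * (\<integral>\<^sup>+q. \<psi> (\<omega>, q) \<partial>?Q) \<partial>M)"
    using history_measurable[OF inner] by (simp add: nn_integral_distr nn_integral_density)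
  finally have "(\<integral>\<^sup>+\<omega>. indicator A \<omega> * \<psi> (\<omega>, ?s \<omega>) \<partial>M)
      = (\<integral>\<^sup>+\<omega>. indicator A \<omega> * (\<integral>\<^sup>+q. \<psi> (\<omega>, q) \<partial>?Q) \<partial>M)" .
  moreover have "indicator {\<omega>. N k \<omega> = n} \<omega> = (indicator A \<omega> :: ennreal)" if "\<omega> \<in> space M" for \<omega>
    using that by (simp add: A_def indicator_def)
  ultimately show ?thesis
    by (simp cong: nn_integral_cong)
qed

section \<open>Conditional expectations as integrals over the data\<close>

lemma data_gradient_measurable:
  "(\<lambda>(\<omega>, p). gradient (\<lambda>y. f y p) (x k \<omega>)) \<in> borel_measurable (G k \<Otimes>\<^sub>M P)"
proof -
  have "(\<lambda>(u, p). gradient (\<lambda>y. f y p) u) \<in> borel_measurable (borel \<Otimes>\<^sub>M P)"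
    by (rule borel_measurable_gradient_of_parametric)
       (auto intro: loss_differentiable borel_measurable_integrable[OF loss_integrable])
  moreover have "(\<lambda>z. (x k (fst z), snd z)) \<in> measurable (G k \<Otimes>\<^sub>M P) (borel \<Otimes>\<^sub>M P)"
    using x_history[of k] by measurable
  ultimately have "(\<lambda>z. case (x k (fst z), snd z) of (u, p) \<Rightarrow> gradient (\<lambda>y. f y p) u)
      \<in> borel_measurable (G k \<Otimes>\<^sub>M P)"
    using measurable_compose by blast
  then show ?thesis
    by (simp add: case_prod_unfold)
qed

text \<open>
  The first data point is the zeroth coordinate of the sample, whatever the sample size; it exists because
  samples are nonempty.
\<close>

lemma freeze_data_point:
  assumes \<phi>: "\<phi> \<in> borel_measurable (G k \<Otimes>\<^sub>M P)"
  shows "(\<integral>\<^sup>+\<omega>. \<phi> (\<omega>, \<xi> k 0 \<omega>) \<partial>M) = (\<integral>\<^sup>+\<omega>. \<integral>\<^sup>+p. \<phi> (\<omega>, p) \<partial>P \<partial>M)"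
proof -
  interpret P: prob_space P by (rule prob_space_P)
  have id: "(\<lambda>\<omega>. \<omega>) \<in> measurable M (G k)"
    by (rule history_measurable[of "\<lambda>\<omega>. \<omega>" k]) simp
  have lhs: "(\<lambda>\<omega>. \<phi> (\<omega>, \<xi> k 0 \<omega>)) \<in> borel_measurable M"
    by (rule measurable_compose[OF measurable_Pair[OF id data_measurable] \<phi>])
  have rhs: "(\<lambda>\<omega>. \<integral>\<^sup>+p. \<phi> (\<omega>, p) \<partial>P) \<in> borel_measurable M"
    using \<phi> by (intro history_measurable[of _ k] P.borel_measurable_nn_integral) simp
  have "(\<integral>\<^sup>+\<omega>. indicator {\<omega>. N k \<omega> = n} \<omega> * \<phi> (\<omega>, \<xi> k 0 \<omega>) \<partial>M)
      = (\<integral>\<^sup>+\<omega>. indicator {\<omega>. N k \<omega> = n} \<omega> * (\<integral>\<^sup>+p. \<phi> (\<omega>, p) \<partial>P) \<partial>M)" for n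
  proof (cases "n = 0")
    case True
    then have "indicator {\<omega>. N k \<omega> = n} \<omega> = (0 :: ennreal)" if "\<omega> \<in> space M" for \<omega>
      using sample_size[OF that, of k] by (simp add: indicator_def)
    then show ?thesis
      by (simp cong: nn_integral_cong)
  next
    case False
    let ?Q = "Pi\<^sub>M {..<n} (\<lambda>_. P)"
    have proj: "(\<lambda>q. q 0) \<in> measurable ?Q P"
      using False by simp
    have "(\<lambda>z. (fst z, snd z 0)) \<in> measurable (G k \<Otimes>\<^sub>M ?Q) (G k \<Otimes>\<^sub>M P)"
      by (intro measurable_Pair measurable_fst measurable_compose[OF measurable_snd proj])
    from measurable_compose[OF this \<phi>]
    have "(\<lambda>z. \<phi> (fst z, snd z 0)) \<in> borel_measurable (G k \<Otimes>\<^sub>M ?Q)" .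
    from freeze_sample[OF this]
    have "(\<integral>\<^sup>+\<omega>. indicator {\<omega>. N k \<omega> = n} \<omega> * \<phi> (\<omega>, \<xi> k 0 \<omega>) \<partial>M)
        = (\<integral>\<^sup>+\<omega>. indicator {\<omega>. N k \<omega> = n} \<omega> * (\<integral>\<^sup>+q. \<phi> (\<omega>, q 0) \<partial>?Q) \<partial>M)"
      using False by simp
    also have "\<dots> = (\<integral>\<^sup>+\<omega>. indicator {\<omega>. N k \<omega> = n} \<omega> * (\<integral>\<^sup>+p. \<phi> (\<omega>, p) \<partial>P) \<partial>M)"
    proof (intro nn_integral_cong arg_cong2[where f = "(*)"] refl)
      fix \<omega> assume "\<omega> \<in> space M"
      then have "(\<lambda>p. \<phi> (\<omega>, p)) \<in> borel_measurable P"
        using measurable_Pair2[OF \<phi>] by (simp add: space_history)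
      moreover have "distr ?Q P (\<lambda>q. q 0) = P"
        using False by (intro distr_PiM_component[where I = "{..<n}" and M = "\<lambda>_. P"]) (auto intro: P.prob_space_axioms)
      ultimately show "(\<integral>\<^sup>+q. \<phi> (\<omega>, q 0) \<partial>?Q) = (\<integral>\<^sup>+p. \<phi> (\<omega>, p) \<partial>P)"
        using nn_integral_distr[OF proj, of "\<lambda>p. \<phi> (\<omega>, p)"] by simp
    qed
    finally show ?thesis .
  qed
  then show ?thesis
    unfolding nn_integral_partition_nat[OF N_measurable[of k] lhs]
      nn_integral_partition_nat[OF N_measurable[of k] rhs] by simp
qed

text \<open>
  A conditional expectation is determined by its integrals over history events, and cutting \<open>\<phi>\<close> off outside
  such an event leaves it a function of the history and the data point.
\<close>

lemma nn_cond_exp_data_point: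
  assumes \<phi>: "\<phi> \<in> borel_measurable (G k \<Otimes>\<^sub>M P)"
  shows "AE \<omega> in M. nn_cond_exp M (G k) (\<lambda>\<omega>. \<phi> (\<omega>, \<xi> k 0 \<omega>)) \<omega> = (\<integral>\<^sup>+p. \<phi> (\<omega>, p) \<partial>P)"
proof -
  interpret P: prob_space P by (rule prob_space_P)
  interpret sub: finite_measure_subalgebra M "G k"
    by unfold_locales (rule history_subalgebra)
  have id: "(\<lambda>\<omega>. \<omega>) \<in> measurable M (G k)"
    by (rule history_measurable[of "\<lambda>\<omega>. \<omega>" k]) simp
  have "AE \<omega> in M. (\<integral>\<^sup>+p. \<phi> (\<omega>, p) \<partial>P) = nn_cond_exp M (G k) (\<lambda>\<omega>. \<phi> (\<omega>, \<xi> k 0 \<omega>)) \<omega>"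
  proof (rule sub.nn_cond_exp_charact)
    show "(\<lambda>\<omega>. \<phi> (\<omega>, \<xi> k 0 \<omega>)) \<in> borel_measurable M"
      by (rule measurable_compose[OF measurable_Pair[OF id data_measurable] \<phi>])
    show "(\<lambda>\<omega>. \<integral>\<^sup>+p. \<phi> (\<omega>, p) \<partial>P) \<in> borel_measurable (G k)"
      using \<phi> by (intro P.borel_measurable_nn_integral) simp
    fix C assume C: "C \<in> sets (G k)"
    have "(\<lambda>z. indicator C (fst z)) \<in> borel_measurable (G k \<Otimes>\<^sub>M P)"
      by (rule measurable_compose[OF measurable_fst borel_measurable_indicator[OF C]])
    then have "(\<lambda>z. \<phi> z * indicator C (fst z)) \<in> borel_measurable (G k \<Otimes>\<^sub>M P)"
      using \<phi> by (rule borel_measurable_times_ennreal[rotated])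
    from freeze_data_point[OF this]
    have "(\<integral>\<^sup>+\<omega>\<in>C. \<phi> (\<omega>, \<xi> k 0 \<omega>) \<partial>M) = (\<integral>\<^sup>+\<omega>. \<integral>\<^sup>+p. \<phi> (\<omega>, p) * indicator C \<omega> \<partial>P \<partial>M)"
      by simp
    also have "\<dots> = (\<integral>\<^sup>+\<omega>\<in>C. (\<integral>\<^sup>+p. \<phi> (\<omega>, p) \<partial>P) \<partial>M)"
    proof (intro nn_integral_cong)
      fix \<omega> assume "\<omega> \<in> space M"
      then have "(\<lambda>p. \<phi> (\<omega>, p)) \<in> borel_measurable P"
        using measurable_Pair2[OF \<phi>] by (simp add: space_history)
      then show "(\<integral>\<^sup>+p. \<phi> (\<omega>, p) * indicator C \<omega> \<partial>P) = (\<integral>\<^sup>+p. \<phi> (\<omega>, p) \<partial>P) * indicator C \<omega>"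
        by (rule nn_integral_multc)
    qed
    finally show "(\<integral>\<^sup>+\<omega>\<in>C. \<phi> (\<omega>, \<xi> k 0 \<omega>) \<partial>M) = (\<integral>\<^sup>+\<omega>\<in>C. (\<integral>\<^sup>+p. \<phi> (\<omega>, p) \<partial>P) \<partial>M)" .
  qed
  then show ?thesis
    by eventually_elim simp
qed

text \<open>
  The conditional expectation of a real function is the difference of those of its positive and negative
  part, each truncated to \<open>0\<close> where it is infinite. The Bochner integral follows the same convention for
  nonnegative functions, so integrability matters only for functions that change sign.
\<close>

lemma real_cond_exp_data_point:
  fixes \<phi> :: "'w \<times> ('z \<times> 'y) \<Rightarrow> real"
  assumes \<phi>: "\<phi> \<in> borel_measurable (G k \<Otimes>\<^sub>M P)"
  shows "AE \<omega> in M. (\<forall>p. 0 \<le> \<phi> (\<omega>, p)) \<or> integrable P (\<lambda>p. \<phi> (\<omega>, p)) \<longrightarrow>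
    real_cond_exp M (G k) (\<lambda>\<omega>. \<phi> (\<omega>, \<xi> k 0 \<omega>)) \<omega> = (\<integral>p. \<phi> (\<omega>, p) \<partial>P)"
proof -
  have "(\<lambda>z. ennreal (\<phi> z)) \<in> borel_measurable (G k \<Otimes>\<^sub>M P)"
    and "(\<lambda>z. ennreal (- \<phi> z)) \<in> borel_measurable (G k \<Otimes>\<^sub>M P)"
    using \<phi> by measurable
  from this[THEN nn_cond_exp_data_point] AE_space show ?thesis
  proof eventually_elim
    case (elim \<omega>)
    then have meas: "(\<lambda>p. \<phi> (\<omega>, p)) \<in> borel_measurable P"
      using measurable_Pair2[OF \<phi>] by (simp add: space_history)
    have rce: "real_cond_exp M (G k) (\<lambda>\<omega>. \<phi> (\<omega>, \<xi> k 0 \<omega>)) \<omega>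
        = enn2real (\<integral>\<^sup>+p. ennreal (\<phi> (\<omega>, p)) \<partial>P) - enn2real (\<integral>\<^sup>+p. ennreal (- \<phi> (\<omega>, p)) \<partial>P)"
      using elim by (simp add: real_cond_exp_def)
    show ?case
    proof (intro impI, elim disjE)
      assume "\<forall>p. 0 \<le> \<phi> (\<omega>, p)"
      then have "0 \<le> \<phi> (\<omega>, p)" and "ennreal (- \<phi> (\<omega>, p)) = 0" for p
        by (simp_all add: ennreal_neg del: split_paired_All)
      then show "real_cond_exp M (G k) (\<lambda>\<omega>. \<phi> (\<omega>, \<xi> k 0 \<omega>)) \<omega> = (\<integral>p. \<phi> (\<omega>, p) \<partial>P)"
        unfolding rce using integral_eq_nn_integral[OF meas] by simp
    next
      assume "integrable P (\<lambda>p. \<phi> (\<omega>, p))"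
      then show "real_cond_exp M (G k) (\<lambda>\<omega>. \<phi> (\<omega>, \<xi> k 0 \<omega>)) \<omega> = (\<integral>p. \<phi> (\<omega>, p) \<partial>P)"
        unfolding rce by (simp add: real_lebesgue_integral_def)
    qed
  qed
qed

text \<open>
  Unbiasedness, the finite second moment and both tests, read for almost every fixed history as statements
  about integrals over a single data point. The finite second moment makes the gradient integrable over the
  data, so that unbiasedness is about a genuine mean.
\<close>

lemma fibrewise_hypotheses:
  assumes F_meas: "gradient F \<in> borel_measurable borel"
    and tests: "inner_product_test M G f F x H N \<xi> \<theta> k" "orthogonality_condition M G f F x H N \<xi> \<nu> k"
  shows "AE \<omega> in M. let h = (\<lambda>p. gradient (\<lambda>y. f y p) (x k \<omega>)); v = H k \<omega> *v gradient F (x k \<omega>) in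
      h \<in> borel_measurable P \<and> integrable P (\<lambda>p. (norm (h p))\<^sup>2) \<and> (\<integral>p. h p \<partial>P) = gradient F (x k \<omega>) \<and>
      (\<integral>p. (v \<bullet> (H k \<omega> *v h p) - (norm v)\<^sup>2)\<^sup>2 \<partial>P) / real (N k \<omega>) \<le> \<theta>\<^sup>2 * norm v ^ 4 \<and>
      (\<integral>p. (norm (H k \<omega> *v h p - (((H k \<omega> *v h p) \<bullet> v) / (norm v)\<^sup>2) *\<^sub>R v))\<^sup>2 \<partial>P) / real (N k \<omega>)
        \<le> \<nu>\<^sup>2 * (norm v)\<^sup>2"
proof -
  interpret P: prob_space P by (rule prob_space_P)
  define h where "h z = gradient (\<lambda>y. f y (snd z)) (x k (fst z))" for z
  have sg: "sample_gradient f x \<xi> k 0 \<omega> = h (\<omega>, \<xi> k 0 \<omega>)" for \<omega>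
    by (simp add: sample_gradient_def h_def)
  have h [measurable]: "h \<in> borel_measurable (G k \<Otimes>\<^sub>M P)"
    using data_gradient_measurable unfolding h_def case_prod_unfold .
  define v where "v \<omega> = H k \<omega> *v gradient F (x k \<omega>)" for \<omega>
  have [measurable]: "v \<in> borel_measurable (G k)"
    unfolding v_def
    by (intro borel_measurable_matrix_vector_mult H_history measurable_compose[OF x_history F_meas])
  have [measurable]: "(\<lambda>z. H k (fst z) *v h z) \<in> borel_measurable (G k \<Otimes>\<^sub>M P)"
    by (intro borel_measurable_matrix_vector_mult measurable_compose[OF measurable_fst H_history] h)
  define inn where "inn z = (v (fst z) \<bullet> (H k (fst z) *v h z) - (norm (v (fst z)))\<^sup>2)\<^sup>2" for z
  define ort where "ort z = (norm (H k (fst z) *v h z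
      - (((H k (fst z) *v h z) \<bullet> v (fst z)) / (norm (v (fst z)))\<^sup>2) *\<^sub>R v (fst z)))\<^sup>2" for z
  have inn: "inn \<in> borel_measurable (G k \<Otimes>\<^sub>M P)"
    unfolding inn_def by measurable
  have ort: "ort \<in> borel_measurable (G k \<Otimes>\<^sub>M P)"
    unfolding ort_def by measurable
  have "(\<lambda>z. h z $ j) \<in> borel_measurable (G k \<Otimes>\<^sub>M P)" for j
    unfolding cart_eq_inner_axis by measurable
  from this[THEN real_cond_exp_data_point]
  have comp: "AE \<omega> in M. \<forall>j. (\<forall>p. 0 \<le> h (\<omega>, p) $ j) \<or> integrable P (\<lambda>p. h (\<omega>, p) $ j) \<longrightarrow>
      real_cond_exp M (G k) (\<lambda>\<omega>. h (\<omega>, \<xi> k 0 \<omega>) $ j) \<omega> = (\<integral>p. h (\<omega>, p) $ j \<partial>P)"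
    unfolding AE_all_countable by blast
  have "(\<lambda>z. ennreal ((norm (h z))\<^sup>2)) \<in> borel_measurable (G k \<Otimes>\<^sub>M P)"
    by measurable
  note moment = nn_cond_exp_data_point[OF this]
  note tests' = tests[unfolded inner_product_test_def orthogonality_condition_def sg]
  show ?thesis
    using real_cond_exp_data_point[OF inn] real_cond_exp_data_point[OF ort] comp moment
      tests' unbiased[of k, unfolded sg] finite_second_moment[of k, unfolded sg] AE_space
  proof eventually_elim
    case (elim \<omega>)
    have meas: "(\<lambda>p. h (\<omega>, p)) \<in> borel_measurable P"
      using measurable_Pair2[OF h] elim by (simp add: space_history)
    have sq: "integrable P (\<lambda>p. (norm (h (\<omega>, p)))\<^sup>2)"
      using elim meas by (intro integrableI_bounded) auto
    have int: "integrable P (\<lambda>p. h (\<omega>, p))"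
      by (rule integrable_square_imp_integrable[OF _ meas sq]) (rule P.finite_measure_axioms)
    then have "integrable P (\<lambda>p. h (\<omega>, p) $ j)" for j
      unfolding cart_eq_inner_axis by simp
    then have "(\<integral>p. h (\<omega>, p) $ j \<partial>P) = gradient F (x k \<omega>) $ j" for j
      using elim by auto
    then have "(\<integral>p. h (\<omega>, p) \<partial>P) = gradient F (x k \<omega>)"
      using int by (simp add: vec_eq_iff cart_eq_inner_axis)
    moreover have "(\<integral>p. inn (\<omega>, p) \<partial>P) / real (N k \<omega>) \<le> \<theta>\<^sup>2 * norm (v \<omega>) ^ 4"
      using elim by (simp add: inn_def v_def)
    moreover have "(\<integral>p. ort (\<omega>, p) \<partial>P) / real (N k \<omega>) \<le> \<nu>\<^sup>2 * (norm (v \<omega>))\<^sup>2"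
      using elim by (simp add: ort_def v_def)
    ultimately show ?case
      using meas sq by (simp add: Let_def h_def inn_def ort_def v_def)
  qed
qed

text \<open>
  Over histories with \<open>N k = n\<close> the next optimality gap is a function of the history and the sample, so the
  sample may be integrated out first; \<open>expected_decrease\<close> bounds the inner integral for almost every history,
  and the pieces are summed over \<open>n\<close>.
\<close>

lemma expected_optimality_gap_step:
  assumes F_meas: "F \<in> borel_measurable borel" "gradient F \<in> borel_measurable borel"
    and lower: "\<And>y v. F y + v \<bullet> gradient F y + \<mu> / 2 * (norm v)\<^sup>2 \<le> F (y + v)"
    and upper: "\<And>y v. F (y + v) \<le> F y + v \<bullet> gradient F y + L / 2 * (norm v)\<^sup>2"
    and min: "\<And>y. F z \<le> F y"
    and tests: "inner_product_test M G f F x H N \<xi> \<theta> k" "orthogonality_condition M G f F x H N \<xi> \<nu> k"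
    and H_bounds: "AE \<omega> in M. \<Lambda>\<^sub>1 *\<^sub>R mat 1 \<preceq> H k \<omega> \<and> H k \<omega> \<preceq> \<Lambda>\<^sub>2 *\<^sub>R mat 1"
    and pos: "0 < \<mu>" "0 < L" "0 < \<Lambda>\<^sub>1" "0 < \<Lambda>\<^sub>2" "0 < \<alpha> k"
    and steplength: "\<alpha> k \<le> 1 / ((1 + \<theta>\<^sup>2 + \<nu>\<^sup>2) * L * \<Lambda>\<^sub>2)"
  shows "(\<integral>\<^sup>+\<omega>. ennreal (F (x (Suc k) \<omega>) - F z) \<partial>M)
    \<le> (\<integral>\<^sup>+\<omega>. ennreal ((1 - \<mu> * \<Lambda>\<^sub>1 * \<alpha> k) * (F (x k \<omega>) - F z)) \<partial>M)"
proof -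
  interpret P: prob_space P by (rule prob_space_P)
  note [measurable] = F_meas
  define h where "h \<omega> p = gradient (\<lambda>y. f y p) (x k \<omega>)" for \<omega> p
  define gap where "gap n \<omega> q = ennreal (F (x k \<omega> - \<alpha> k *\<^sub>R
      (H k \<omega> *v ((1 / real n) *\<^sub>R (\<Sum>i<n. h \<omega> (q i))))) - F z)" for n \<omega> q
  have fibre: "AE \<omega> in M. (\<integral>\<^sup>+q. gap (N k \<omega>) \<omega> q \<partial>Pi\<^sub>M {..<N k \<omega>} (\<lambda>_. P))
      \<le> ennreal ((1 - \<mu> * \<Lambda>\<^sub>1 * \<alpha> k) * (F (x k \<omega>) - F z))"
    using fibrewise_hypotheses[OF F_meas(2) tests] H_bounds AE_space
  proof eventually_elim
    case (elim \<omega>)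
    then show ?case
      unfolding gap_def h_def Let_def
      using sample_size[of \<omega> k] H_pos_definite[of \<omega> k]
      by (intro P.expected_decrease[OF _ _ _ _ lower upper min, where \<Lambda>\<^sub>2 = \<Lambda>\<^sub>2 and \<theta> = \<theta> and \<nu> = \<nu>]
          pos steplength) auto
  qed
  have step_n: "(\<integral>\<^sup>+\<omega>. indicator {\<omega>. N k \<omega> = n} \<omega> * ennreal (F (x (Suc k) \<omega>) - F z) \<partial>M)
      \<le> (\<integral>\<^sup>+\<omega>. indicator {\<omega>. N k \<omega> = n} \<omega>
          * ennreal ((1 - \<mu> * \<Lambda>\<^sub>1 * \<alpha> k) * (F (x k \<omega>) - F z)) \<partial>M)" for n
  proof -
    let ?Q = "Pi\<^sub>M {..<n} (\<lambda>_. P)"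
    have h_comp: "(\<lambda>z. h (fst z) (snd z i)) \<in> borel_measurable (G k \<Otimes>\<^sub>M ?Q)" if "i < n" for i
    proof -
      have "(\<lambda>q. q i) \<in> measurable ?Q P"
        using that by simp
      then have "(\<lambda>z. (fst z, snd z i)) \<in> measurable (G k \<Otimes>\<^sub>M ?Q) (G k \<Otimes>\<^sub>M P)"
        by (intro measurable_Pair measurable_fst measurable_compose[OF measurable_snd])
      from measurable_compose[OF this data_gradient_measurable] show ?thesis
        by (simp add: h_def)
    qed
    have [measurable]: "(\<lambda>z. H k (fst z) *v ((1 / real n) *\<^sub>R (\<Sum>i<n. h (fst z) (snd z i))))
        \<in> borel_measurable (G k \<Otimes>\<^sub>M ?Q)"
      by (intro borel_measurable_matrix_vector_mult measurable_compose[OF measurable_fst H_history]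
          borel_measurable_scaleR borel_measurable_const borel_measurable_sum h_comp) simp
    have [measurable]: "(\<lambda>z. x k (fst z)) \<in> borel_measurable (G k \<Otimes>\<^sub>M ?Q)"
      by (rule measurable_compose[OF measurable_fst x_history])
    have gap: "(\<lambda>z. gap n (fst z) (snd z)) \<in> borel_measurable (G k \<Otimes>\<^sub>M ?Q)"
      unfolding gap_def by measurable
    have "indicator {\<omega>. N k \<omega> = n} \<omega> * ennreal (F (x (Suc k) \<omega>) - F z)
        = indicator {\<omega>. N k \<omega> = n} \<omega> * gap n \<omega> (\<lambda>i\<in>{..<n}. \<xi> k i \<omega>)" if "\<omega> \<in> space M" for \<omega>
      using step[OF that, of k]
      by (auto simp: indicator_def gap_def h_def batch_gradient_def sample_gradient_def)
    then have "(\<integral>\<^sup>+\<omega>. indicator {\<omega>. N k \<omega> = n} \<omega> * ennreal (F (x (Suc k) \<omega>) - F z) \<partial>M)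
        = (\<integral>\<^sup>+\<omega>. indicator {\<omega>. N k \<omega> = n} \<omega> * gap n \<omega> (\<lambda>i\<in>{..<n}. \<xi> k i \<omega>) \<partial>M)"
      by (intro nn_integral_cong)
    also have "\<dots> = (\<integral>\<^sup>+\<omega>. indicator {\<omega>. N k \<omega> = n} \<omega> * (\<integral>\<^sup>+q. gap n \<omega> q \<partial>?Q) \<partial>M)"
      using freeze_sample[OF gap] by simp
    also have "\<dots> \<le> (\<integral>\<^sup>+\<omega>. indicator {\<omega>. N k \<omega> = n} \<omega>
          * ennreal ((1 - \<mu> * \<Lambda>\<^sub>1 * \<alpha> k) * (F (x k \<omega>) - F z)) \<partial>M)"
    proof (rule nn_integral_mono_AE)
      show "AE \<omega> in M. indicator {\<omega>. N k \<omega> = n} \<omega> * (\<integral>\<^sup>+q. gap n \<omega> q \<partial>?Q)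
          \<le> indicator {\<omega>. N k \<omega> = n} \<omega> * ennreal ((1 - \<mu> * \<Lambda>\<^sub>1 * \<alpha> k) * (F (x k \<omega>) - F z))"
        using fibre by eventually_elim (auto simp: indicator_def)
    qed
    finally show ?thesis .
  qed
  have x_meas [measurable]: "x j \<in> borel_measurable M" for j
    by (rule history_measurable[OF x_history])
  have meas: "(\<lambda>\<omega>. ennreal (F (x (Suc k) \<omega>) - F z)) \<in> borel_measurable M"
      "(\<lambda>\<omega>. ennreal ((1 - \<mu> * \<Lambda>\<^sub>1 * \<alpha> k) * (F (x k \<omega>) - F z))) \<in> borel_measurable M"
    by measurable
  show ?thesis
    unfolding nn_integral_partition_nat[OF N_measurable[of k] meas(1)]
      nn_integral_partition_nat[OF N_measurable[of k] meas(2)]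
    by (intro suminf_le step_n) auto
qed

end

section \<open>Linear convergence\<close>

theorem theorem3p1:
  fixes M :: "'w measure" and G :: "nat \<Rightarrow> 'w measure"
    and P :: "('z \<times> 'y) measure"
    and f :: "real^'d \<Rightarrow> 'z \<times> 'y \<Rightarrow> real"
    and F :: "real^'d \<Rightarrow> real"
    and x0 xstar :: "real^'d"
    and x :: "nat \<Rightarrow> 'w \<Rightarrow> real^'d"
    and H :: "nat \<Rightarrow> 'w \<Rightarrow> real^'d^'d"
    and N :: "nat \<Rightarrow> 'w \<Rightarrow> nat"
    and \<xi> :: "nat \<Rightarrow> nat \<Rightarrow> 'w \<Rightarrow> 'z \<times> 'y"
    and \<alpha> \<mu> L \<theta> \<nu> \<Lambda>\<^sub>1 \<Lambda>\<^sub>2 :: real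
  assumes "stochastic_quasi_newton M G P f F x0 x H N \<xi> (\<lambda>_. \<alpha>)"
    and "twice_continuously_differentiable F"
    and "0 < \<mu>" and "\<mu> \<le> L"
    and "\<And>y. \<mu> *\<^sub>R mat 1 \<preceq> hessian F y \<and> hessian F y \<preceq> L *\<^sub>R mat 1"
    and "0 < \<theta>" and "0 < \<nu>" and "0 < \<Lambda>\<^sub>1" and "\<Lambda>\<^sub>1 \<le> \<Lambda>\<^sub>2"
    and "\<And>k. inner_product_test M G f F x H N \<xi> \<theta> k"
    and "\<And>k. orthogonality_condition M G f F x H N \<xi> \<nu> k"
    and "\<And>k. AE \<omega> in M. \<Lambda>\<^sub>1 *\<^sub>R mat 1 \<preceq> H k \<omega> \<and> H k \<omega> \<preceq> \<Lambda>\<^sub>2 *\<^sub>R mat 1"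
    and "0 < \<alpha>" and "\<alpha> \<le> 1 / ((1 + \<theta>\<^sup>2 + \<nu>\<^sup>2) * L * \<Lambda>\<^sub>2)"
    and "\<And>y. F xstar \<le> F y"
  shows "\<forall>k. integrable M (\<lambda>\<omega>. F (x k \<omega>) - F xstar) \<and>
             (\<integral>\<omega>. F (x k \<omega>) - F xstar \<partial>M) \<le> (1 - \<mu> * \<Lambda>\<^sub>1 * \<alpha>) ^ k * (F x0 - F xstar)"
proof
  fix k
  interpret stochastic_quasi_newton M G P f F x0 x H N \<xi> "\<lambda>_. \<alpha>"
    by fact
  let ?\<rho> = "1 - \<mu> * \<Lambda>\<^sub>1 * \<alpha>"
  have "continuous_on UNIV F" "continuous_on UNIV (gradient F)"
    using \<open>twice_continuously_differentiable F\<close> unfolding twice_continuously_differentiable_def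
    by (auto intro!: continuous_at_imp_continuous_on differentiable_imp_continuous_within)
  then have F_meas [measurable]: "F \<in> borel_measurable borel" "gradient F \<in> borel_measurable borel"
    by (auto intro: borel_measurable_continuous_onI)
  have pos: "0 < \<mu>" "0 < L" "0 < \<Lambda>\<^sub>1" "0 < \<Lambda>\<^sub>2" "0 < \<alpha>"
    using assms by linarith+
  \<comment> \<open>without it the recursion could not be iterated\<close>
  have rho_nonneg: "0 \<le> ?\<rho>"
  proof -
    have c: "1 \<le> 1 + \<theta>\<^sup>2 + \<nu>\<^sup>2"
      by simp
    have "\<mu> * \<Lambda>\<^sub>1 \<le> L * \<Lambda>\<^sub>2"
      using assms pos by (intro mult_mono) auto
    also have "\<dots> \<le> (1 + \<theta>\<^sup>2 + \<nu>\<^sup>2) * (L * \<Lambda>\<^sub>2)"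
      using c pos mult_right_mono[OF c, of "L * \<Lambda>\<^sub>2"] by simp
    finally have le: "\<mu> * \<Lambda>\<^sub>1 \<le> (1 + \<theta>\<^sup>2 + \<nu>\<^sup>2) * L * \<Lambda>\<^sub>2"
      by (simp add: mult.assoc)
    have "0 < \<mu> * \<Lambda>\<^sub>1"
      using pos by simp
    then have "0 < (1 + \<theta>\<^sup>2 + \<nu>\<^sup>2) * L * \<Lambda>\<^sub>2"
      using le by linarith
    then have "\<alpha> * ((1 + \<theta>\<^sup>2 + \<nu>\<^sup>2) * L * \<Lambda>\<^sub>2) \<le> 1"
      using \<open>\<alpha> \<le> 1 / ((1 + \<theta>\<^sup>2 + \<nu>\<^sup>2) * L * \<Lambda>\<^sub>2)\<close> by (simp only: pos_le_divide_eq)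
    moreover have "\<alpha> * (\<mu> * \<Lambda>\<^sub>1) \<le> \<alpha> * ((1 + \<theta>\<^sup>2 + \<nu>\<^sup>2) * L * \<Lambda>\<^sub>2)"
      using le pos by (intro mult_left_mono) auto
    ultimately show ?thesis
      by (simp add: mult.commute)
  qed
  have x_meas [measurable]: "x k \<in> borel_measurable M" for k
    by (rule history_measurable[OF x_history])
  have gap_nonneg: "0 \<le> F y - F xstar" for y
    using \<open>\<And>y. F xstar \<le> F y\<close>[of y] by simp
  have bound: "(\<integral>\<^sup>+\<omega>. ennreal (F (x k \<omega>) - F xstar) \<partial>M) \<le> ennreal (?\<rho> ^ k * (F x0 - F xstar))" for k
  proof (induction k)
    case 0
    have "(\<integral>\<^sup>+\<omega>. ennreal (F (x 0 \<omega>) - F xstar) \<partial>M) = (\<integral>\<^sup>+\<omega>. ennreal (F x0 - F xstar) \<partial>M)"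
      by (intro nn_integral_cong) (simp add: initial)
    then show ?case
      by (simp add: emeasure_space_1)
  next
    case (Suc k)
    have "(\<integral>\<^sup>+\<omega>. ennreal (F (x (Suc k) \<omega>) - F xstar) \<partial>M)
        \<le> (\<integral>\<^sup>+\<omega>. ennreal (?\<rho> * (F (x k \<omega>) - F xstar)) \<partial>M)"
      by (rule expected_optimality_gap_step[OF F_meas quadratic_bounds[OF assms(2,5)] assms(15,10,11,12) pos assms(14)])
    also have "\<dots> = ennreal ?\<rho> * (\<integral>\<^sup>+\<omega>. ennreal (F (x k \<omega>) - F xstar) \<partial>M)"
      using rho_nonneg gap_nonneg by (simp add: ennreal_mult nn_integral_cmult)
    also have "\<dots> \<le> ennreal ?\<rho> * ennreal (?\<rho> ^ k * (F x0 - F xstar))"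
      by (intro mult_left_mono Suc.IH) simp
    also have "\<dots> = ennreal (?\<rho> ^ Suc k * (F x0 - F xstar))"
      using rho_nonneg gap_nonneg[of x0] by (simp add: ennreal_mult[symmetric] mult.assoc)
    finally show ?case .
  qed
  have int: "integrable M (\<lambda>\<omega>. F (x k \<omega>) - F xstar)"
    using bound[of k] gap_nonneg
    by (intro integrableI_nonneg) (auto simp: less_top[symmetric] top_unique)
  have "ennreal (\<integral>\<omega>. F (x k \<omega>) - F xstar \<partial>M) \<le> ennreal (?\<rho> ^ k * (F x0 - F xstar))"
    using bound[of k] nn_integral_eq_integral[OF int] gap_nonneg by simp
  then have "(\<integral>\<omega>. F (x k \<omega>) - F xstar \<partial>M) \<le> ?\<rho> ^ k * (F x0 - F xstar)"
    using rho_nonneg gap_nonneg[of x0] by (simp add: ennreal_le_iff)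
  with int show "integrable M (\<lambda>\<omega>. F (x k \<omega>) - F xstar) \<and>
      (\<integral>\<omega>. F (x k \<omega>) - F xstar \<partial>M) \<le> ?\<rho> ^ k * (F x0 - F xstar)"
    by simp
qed

end
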